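(* Let $K$ be a local field with ring of integers $\mathcal O$ and residue field of size $q$. Then there is an isometric isomorphism of $K$-Banach algebras $$K\langle X_0,X_1,\dots\rangle/I_q(K)\cong C(\mathcal O,K).$$
   Context: A local field is a field complete with respect to a nontrivial discrete nonarchimedean absolute value with finite residue field. $K\langle X_0,X_1,\dots\rangle$ is the set of formal power series $\sum_ia_i\underline X^i$ in countably many indeterminates $X_0,X_1,\dots$ with $a_i\to0$ (for each $\varepsilon>0$ only finitely many $|a_i|\ge\varepsilon$), a $K$-Banach algebra under the norm $\sup_i|a_i|$. $I_q(K)$ is the closure of the ideal generated by all $X_j^q-X_j$, and the quotient carries the residue norm $|f\bmod I|=\inf_{h\in I}|f+h|$. $C(\mathcal O,K)$ is the $K$-Banach algebra of continuous functions $\mathcal O\to K$ with the sup-norm and pointwise operations. *)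

theory Defs
  imports Complex_Main "HOL-Library.Poly_Mapping" "HOL-Library.Function_Algebras"
begin

definition abs_value :: "('k::field \<Rightarrow> real) \<Rightarrow> bool" where
  "abs_value v \<longleftrightarrow> (\<forall>x. v x \<ge> 0) \<and> (\<forall>x. v x = 0 \<longleftrightarrow> x = 0) \<and>
     (\<forall>x y. v (x * y) = v x * v y) \<and> (\<forall>x y. v (x + y) \<le> max (v x) (v y))"

definition val_ring :: "('k::field \<Rightarrow> real) \<Rightarrow> 'k set" where
  "val_ring v = {x. v x \<le> 1}"

definition residue_rel :: "('k::field \<Rightarrow> real) \<Rightarrow> ('k \<times> 'k) set" where
  "residue_rel v = {(x, y). x \<in> val_ring v \<and> y \<in> val_ring v \<and> v (x - y) < 1}"

definition residue_field :: "('k::field \<Rightarrow> real) \<Rightarrow> 'k set set" where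
  "residue_field v = val_ring v // residue_rel v"

definition v_cauchy :: "('k::field \<Rightarrow> real) \<Rightarrow> (nat \<Rightarrow> 'k) \<Rightarrow> bool" where
  "v_cauchy v X \<longleftrightarrow> (\<forall>e>0. \<exists>N. \<forall>m\<ge>N. \<forall>n\<ge>N. v (X m - X n) < e)"

definition v_converges :: "('k::field \<Rightarrow> real) \<Rightarrow> (nat \<Rightarrow> 'k) \<Rightarrow> 'k \<Rightarrow> bool" where
  "v_converges v X L \<longleftrightarrow> (\<forall>e>0. \<exists>N. \<forall>n\<ge>N. v (X n - L) < e)"

definition local_field :: "('k::field \<Rightarrow> real) \<Rightarrow> bool" where
  "local_field v \<longleftrightarrow> abs_value v
     \<and> (\<exists>x. x \<noteq> 0 \<and> v x \<noteq> 1)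
     \<and> (\<forall>x. x \<noteq> 0 \<longrightarrow> (\<exists>e>0. \<forall>y. y \<noteq> 0 \<and> \<bar>v y - v x\<bar> < e \<longrightarrow> v y = v x))
     \<and> (\<forall>X. v_cauchy v X \<longrightarrow> (\<exists>L. v_converges v X L))
     \<and> finite (residue_field v)"

text \<open>A series is its coefficient function on monomials (finitely supported exponent vectors).\<close>
type_synonym 'k rseries = "(nat \<Rightarrow>\<^sub>0 nat) \<Rightarrow> 'k"

definition restricted :: "('k::field \<Rightarrow> real) \<Rightarrow> 'k rseries set" where
  "restricted v = {f. \<forall>e>0. finite {m. v (f m) \<ge> e}}"

definition rs_norm :: "('k::field \<Rightarrow> real) \<Rightarrow> 'k rseries \<Rightarrow> real" where
  "rs_norm v f = Sup (range (\<lambda>m. v (f m)))"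

definition rs_mult :: "'k::field rseries \<Rightarrow> 'k rseries \<Rightarrow> 'k rseries" where
  "rs_mult f g = (\<lambda>m. \<Sum>p\<in>{p. fst p + snd p = m}. f (fst p) * g (snd p))"

definition rs_smult :: "'k::field \<Rightarrow> 'k rseries \<Rightarrow> 'k rseries" where
  "rs_smult c f = (\<lambda>m. c * f m)"

definition rs_one :: "'k::field rseries" where
  "rs_one = (\<lambda>m. if m = 0 then 1 else 0)"

definition rs_var_pow :: "nat \<Rightarrow> nat \<Rightarrow> 'k::field rseries" where
  "rs_var_pow j n = (\<lambda>m. if m = Poly_Mapping.single j n then 1 else 0)"

definition Iq_gen :: "nat \<Rightarrow> nat \<Rightarrow> 'k::field rseries" where
  "Iq_gen q j = rs_var_pow j q - rs_var_pow j 1"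

definition gen_ideal :: "('k::field \<Rightarrow> real) \<Rightarrow> nat \<Rightarrow> 'k rseries set" where
  "gen_ideal v q = {f. \<exists>J h. finite J \<and> (\<forall>j\<in>J. h j \<in> restricted v) \<and>
                         f = (\<Sum>j\<in>J. rs_mult (h j) (Iq_gen q j))}"

definition Iq :: "('k::field \<Rightarrow> real) \<Rightarrow> nat \<Rightarrow> 'k rseries set" where
  "Iq v q = {f \<in> restricted v. \<forall>e>0. \<exists>h\<in>gen_ideal v q. rs_norm v (f - h) < e}"

definition residue_norm :: "('k::field \<Rightarrow> real) \<Rightarrow> nat \<Rightarrow> 'k rseries \<Rightarrow> real" where
  "residue_norm v q f = Inf {rs_norm v (f + h) | h. h \<in> Iq v q}"

definition quot_class :: "('k::field \<Rightarrow> real) \<Rightarrow> nat \<Rightarrow> 'k rseries \<Rightarrow> 'k rseries set" where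
  "quot_class v q f = {g \<in> restricted v. f - g \<in> Iq v q}"

definition rs_quotient :: "('k::field \<Rightarrow> real) \<Rightarrow> nat \<Rightarrow> 'k rseries set set" where
  "rs_quotient v q = quot_class v q ` restricted v"

text \<open>Represented extensionally: functions vanishing outside \<open>\<O>\<close>.\<close>
definition cont_funs :: "('k::field \<Rightarrow> real) \<Rightarrow> ('k \<Rightarrow> 'k) set" where
  "cont_funs v = {f. (\<forall>x. x \<notin> val_ring v \<longrightarrow> f x = 0) \<and>
     (\<forall>x\<in>val_ring v. \<forall>e>0. \<exists>d>0. \<forall>y\<in>val_ring v. v (y - x) < d \<longrightarrow> v (f y - f x) < e)}"

definition sup_norm :: "('k::field \<Rightarrow> real) \<Rightarrow> ('k \<Rightarrow> 'k) \<Rightarrow> real" where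
  "sup_norm v f = Sup ((\<lambda>x. v (f x)) ` val_ring v)"

end

theory Submission
  imports Defs "HOL-Library.FuncSet" "HOL-Computational_Algebra.Polynomial"
begin

text \<open>Every \<open>x \<in> \<O>\<close> has a unique expansion \<open>x = \<Sum>\<^sub>j d\<^sub>j(x) \<pi>\<^sup>j\<close> with Teichmueller digits, i.e. roots of
  \<open>X\<^sup>q - X\<close>, and the isomorphism sends \<open>X\<^sub>j\<close> to the function \<open>d\<^sub>j\<close>. Lagrange interpolation on the grid of the
  first \<open>n\<close> digits has integral coefficients, since distinct roots are incongruent modulo \<open>\<pi>\<close>. Hence a
  polynomial is congruent, modulo the generators of \<open>I\<^sub>q\<close>, to a polynomial whose norm is the supremum of the
  values; by density the kernel of evaluation is exactly \<open>I\<^sub>q\<close>. Interpolating a continuous function on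
  finer and finer grids gives a sequence of polynomials which, by uniform continuity, converges to a
  preimage of norm at most the sup-norm. So evaluation is onto and isometric on the quotient.\<close>

section \<open>Teichmueller representatives\<close>

text \<open>The digit map identifies O with the space of all sequences of roots of X^q - X. There
  the X_j become independent coordinates, so statements about O turn into statements about finite
  grids of roots. An isometry, and not merely a bounded isomorphism, requires interpolation without
  any loss in the norm. The denominators of the Lagrange polynomials are the values of the
  derivative q X^(q-1) - 1 at the roots, namely -1 at 0 and q - 1 elsewhere. Both are units because
  q lies in the maximal ideal, and by the ultrametric inequality the number of grid points does not
  enter the bound. The second obstacle is that I_q is a closure, while algebra only reaches finite
  combinations of the generators. A polynomial p close to a series that vanishes on O need not
  vanish on the grid. Its values there are merely small, and it is its interpolant, equally small,
  that corrects p to an element of the ideal. Interpolants on different grids can be compared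
  because the one-variable Lagrange polynomials sum to 1: a function that ignores the newest digit
  keeps its interpolant on the larger grid.\<close>

locale nonarch_field =
  fixes v :: "'k::field \<Rightarrow> real"
  assumes abs_value: "abs_value v"
begin

lemma v_nonneg [simp]: "0 \<le> v x"
  and v_eq_0_iff [simp]: "v x = 0 \<longleftrightarrow> x = 0"
  and v_mult: "v (x * y) = v x * v y"
  and v_add: "v (x + y) \<le> max (v x) (v y)"
  using abs_value by (simp_all add: abs_value_def)

lemma v_zero [simp]: "v 0 = 0"
  by simp

lemma v_pos_iff [simp]: "0 < v x \<longleftrightarrow> x \<noteq> 0"
  using v_nonneg[of x] v_eq_0_iff[of x] by linarith

lemma v_one [simp]: "v 1 = 1"
  using v_mult[of 1 1] v_eq_0_iff[of 1] by simp

lemma v_power: "v (x ^ n) = v x ^ n"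
  by (induction n) (simp_all add: v_mult)

lemma v_minus [simp]: "v (- x) = v x"
proof -
  have "v (- 1) ^ 2 = 1"
    by (simp flip: v_power)
  then have "v (- 1) = 1"
    using v_nonneg[of "-1"] by (simp add: power2_eq_1_iff)
  then show ?thesis
    using v_mult[of "-1" x] by simp
qed

lemma v_minus_commute: "v (x - y) = v (y - x)"
  using v_minus[of "x - y"] by simp

lemma v_diff: "v (x - y) \<le> max (v x) (v y)"
  using v_add[of x "- y"] by simp

lemma v_add_le: "v x \<le> c \<Longrightarrow> v y \<le> c \<Longrightarrow> v (x + y) \<le> c"
  using v_add[of x y] by simp

lemma v_diff_le: "v x \<le> c \<Longrightarrow> v y \<le> c \<Longrightarrow> v (x - y) \<le> c"
  using v_diff[of x y] by simp

lemma v_triangle: "v (x - y) \<le> c \<Longrightarrow> v (y - z) \<le> c \<Longrightarrow> v (x - z) \<le> c"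
  using v_add_le[of "x - y" c "y - z"] by simp

lemma v_triangle_less: "v (x - y) < c \<Longrightarrow> v (y - z) < c \<Longrightarrow> v (x - z) < c"
  using v_add[of "x - y" "y - z"] by simp

lemma v_inverse: "v (inverse x) = inverse (v x)"
proof (cases "x = 0")
  case False
  then have "v (inverse x) * v x = 1"
    by (simp flip: v_mult)
  then show ?thesis
    by (metis inverse_unique mult.commute)
qed auto

lemma v_divide: "v (x / y) = v x / v y"
  by (simp add: divide_inverse v_mult v_inverse)

lemma v_sum_le: "(\<And>i. i \<in> A \<Longrightarrow> v (f i) \<le> c) \<Longrightarrow> 0 \<le> c \<Longrightarrow> v (sum f A) \<le> c"
  by (induction A rule: infinite_finite_induct) (auto intro: v_add_le)

lemma v_sum_less: "(\<And>i. i \<in> A \<Longrightarrow> v (f i) < c) \<Longrightarrow> 0 < c \<Longrightarrow> v (sum f A) < c"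
proof (induction A rule: infinite_finite_induct)
  case (insert x A)
  then show ?case
    using v_add[of "f x" "sum f A"] by fastforce
qed auto

lemma v_prod: "v (prod f A) = (\<Prod>i\<in>A. v (f i))"
  by (induction A rule: infinite_finite_induct) (auto simp: v_mult)

lemma v_mult_le_1: "v x \<le> 1 \<Longrightarrow> v y \<le> 1 \<Longrightarrow> v (x * y) \<le> 1"
  by (simp add: v_mult mult_le_one)

lemma v_mult_less_1: "v x \<le> 1 \<Longrightarrow> v y < 1 \<Longrightarrow> v (x * y) < 1"
  using mult_left_le_one_le[of "v y" "v x"] by (simp add: v_mult)

lemma v_power_le_1: "v x \<le> 1 \<Longrightarrow> v (x ^ n) \<le> 1"
  by (simp add: v_power power_le_one)

lemma v_prod_le_1: "(\<And>i. i \<in> A \<Longrightarrow> v (f i) \<le> 1) \<Longrightarrow> v (prod f A) \<le> 1"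
  by (simp add: v_prod prod_le_1)

lemma v_eq_1_cong: "v x = 1" if "v (x - y) < 1" "v y = 1"
  using v_add[of "x - y" y] v_diff[of x "x - y"] that by auto

text \<open>Factors may be exchanged one at a time modulo the maximal ideal, as long as all of them
  are integral.\<close>

lemma v_prod_cong:
  assumes "\<And>i. i \<in> A \<Longrightarrow> v (f i) \<le> 1" "\<And>i. i \<in> A \<Longrightarrow> v (g i) \<le> 1"
    and "\<And>i. i \<in> A \<Longrightarrow> v (f i - g i) < 1"
  shows "v (prod f A - prod g A) < 1"
  using assms
proof (induction A rule: infinite_finite_induct)
  case (insert x A)
  have "prod f (insert x A) - prod g (insert x A) =
      f x * (prod f A - prod g A) + (f x - g x) * prod g A"
    using insert.hyps by (simp add: algebra_simps)
  moreover have "v (f x * (prod f A - prod g A)) < 1"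
    using insert by (intro v_mult_less_1) auto
  moreover have "v (prod g A * (f x - g x)) < 1"
    using insert by (intro v_mult_less_1 v_prod_le_1) auto
  ultimately show ?case
    using v_add[of "f x * (prod f A - prod g A)" "prod g A * (f x - g x)"] by (simp add: mult.commute)
qed auto

lemma eq_if_v_diff_small: "x = y" if "\<And>e. 0 < e \<Longrightarrow> v (x - y) \<le> e"
  using that[of "v (x - y) / 2"] by (cases "x = y") auto

lemma v_limit_le:
  assumes "v_converges v X L" "\<And>n. n \<ge> N \<Longrightarrow> v (X n - c) \<le> e"
  shows "v (L - c) \<le> e"
proof (rule ccontr)
  assume less: "\<not> v (L - c) \<le> e"
  moreover have "0 \<le> e"
    using assms(2)[of N] v_nonneg order_trans by blast
  ultimately obtain M where M: "\<And>n. n \<ge> M \<Longrightarrow> v (X n - L) < v (L - c)"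
    using assms(1) unfolding v_converges_def by (metis le_less_trans not_le)
  have "v (X (max M N) - L) < v (L - c)" "v (X (max M N) - c) \<le> e"
    using M assms(2) by auto
  then show False
    using less v_diff[of "X (max M N) - c" "X (max M N) - L"] by simp
qed

end

section \<open>Completeness, uniformizer and arithmetic modulo the maximal ideal\<close>

locale nonarch_local_field = nonarch_field v for v :: "'k::field \<Rightarrow> real" +
  fixes q :: nat
  assumes local_field: "local_field v" and q_eq: "q = card (residue_field v)"
begin

text \<open>In an ultrametric the distance between two terms is at most the largest step between
  them, so steps tending to 0 already make a sequence Cauchy.\<close>

lemma converges_if_steps_small:
  assumes "\<And>e. 0 < e \<Longrightarrow> \<exists>N. \<forall>n\<ge>N. v (X (Suc n) - X n) \<le> e"
  obtains L where "v_converges v X L"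
proof -
  have "v_cauchy v X"
    unfolding v_cauchy_def
  proof (intro allI impI)
    fix e :: real assume "0 < e"
    then obtain N where N: "\<And>n. n \<ge> N \<Longrightarrow> v (X (Suc n) - X n) \<le> e / 2"
      using assms[of "e / 2"] by auto
    have near: "v (X n - X N) \<le> e / 2" if "n \<ge> N" for n
      using that
    proof (induction n rule: dec_induct)
      case base
      then show ?case using \<open>0 < e\<close> by simp
    next
      case (step n)
      then show ?case using N v_triangle by blast
    qed
    have "v (X m - X n) < e" if "m \<ge> N" "n \<ge> N" for m n
      using v_diff_le[OF near near, OF that] \<open>0 < e\<close> by simp
    then show "\<exists>N. \<forall>m\<ge>N. \<forall>n\<ge>N. v (X m - X n) < e"
      by blast
  qed
  then show ?thesis
    using that local_field unfolding local_field_def by blast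
qed

text \<open>The values are isolated at 1: no value lies strictly between 1 - e and 1. If
  \<open>v w\<close> is within the factor 1 - e of the supremum of the values below 1, a larger
  value \<open>v y\<close> below 1 would put \<open>v (w / y)\<close> into this gap, so the supremum
  is attained.\<close>

lemma ex_uniformizer: "\<exists>w. 0 < v w \<and> v w < 1 \<and> (\<forall>y. v y < 1 \<longrightarrow> v y \<le> v w)"
proof -
  obtain e where e: "e > 0" "\<And>y. y \<noteq> 0 \<Longrightarrow> \<bar>v y - v 1\<bar> < e \<Longrightarrow> v y = v 1"
    using local_field unfolding local_field_def by (metis one_neq_zero)
  obtain x where x: "x \<noteq> 0" "v x \<noteq> 1"
    using local_field unfolding local_field_def by blast
  define x' where "x' = (if v x < 1 then x else inverse x)"
  have x': "0 < v x'" "v x' < 1"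
    using x by (auto simp: x'_def v_inverse inverse_less_1_iff)
  define S where "S = {v y |y. v y < 1}"
  have bdd: "bdd_above S"
    unfolding S_def by (rule bdd_aboveI[of _ 1]) auto
  have ne: "S \<noteq> {}"
    using x' unfolding S_def by blast
  have upper: "v y \<le> Sup S" if "v y < 1" for y
    using cSup_upper[OF _ bdd] that unfolding S_def by blast
  have pos: "0 < Sup S"
    using upper[OF x'(2)] x'(1) by linarith
  then have "Sup S * (1 - e) < Sup S"
    using e(1) by simp
  then obtain w where w: "v w < 1" "Sup S * (1 - e) < v w" "0 < v w"
  \<comment> \<open>For large \<open>e\<close> the lower bound may be negative, and an element found
    near the supremum could then be 0. Either \<open>x'\<close> itself serves, or the bound is at
    least \<open>v x' > 0\<close>.\<close>
  proof (cases "Sup S * (1 - e) < v x'")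
    case False
    obtain s where "s \<in> S" "Sup S * (1 - e) < s"
      using less_cSupE[OF \<open>Sup S * (1 - e) < Sup S\<close> ne] by blast
    moreover from this False x' have "0 < s"
      by linarith
    ultimately show ?thesis
      using that unfolding S_def by blast
  next
    case True
    then show ?thesis
      using that[of x'] x' by blast
  qed
  have "v y \<le> v w" if y: "v y < 1" for y
  proof (rule ccontr)
    assume *: "\<not> v y \<le> v w"
    then have vy: "0 < v y" "v w < v y"
      using w(3) by auto
    have "(1 - e) * v y < v w"
    proof (cases "1 - e > 0")
      case True
      then have "(1 - e) * v y \<le> (1 - e) * Sup S"
        using upper[OF y] by (intro mult_left_mono) auto
      also have "\<dots> < v w"
        using w(2) by (simp add: mult.commute)
      finally show ?thesis .
    next
      case False
      then show ?thesis
        using w(3) vy(1) mult_nonpos_nonneg[of "1 - e" "v y"] by linarith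
    qed
    then have "1 - e < v (w / y)" "v (w / y) < 1"
      using vy by (auto simp: v_divide pos_less_divide_eq)
    then have "v (w / y) = v 1"
      using e(2)[of "w / y"] vy w(3) by auto
    then show False
      using \<open>v (w / y) < 1\<close> by simp
  qed
  then show ?thesis
    using w by blast
qed

definition unif :: 'k
  where "unif = (SOME w. 0 < v w \<and> v w < 1 \<and> (\<forall>y. v y < 1 \<longrightarrow> v y \<le> v w))"

lemma unif_nonzero [simp]: "unif \<noteq> 0"
  and v_unif_less_1: "v unif < 1"
  and v_le_v_unif: "v y < 1 \<Longrightarrow> v y \<le> v unif"
  using someI_ex[OF ex_uniformizer] unfolding unif_def by auto

lemma ex_unif_power_less: "0 < e \<Longrightarrow> \<exists>n. v unif ^ n < e"
  using real_arch_pow_inv v_unif_less_1 by blast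

text \<open>One integral representative for each residue class. Working with representatives and the
  relation \<open>v (s - t) < 1\<close> stands in for a field structure on the quotient set.\<close>

definition is_transversal :: "'k set \<Rightarrow> bool" where
  "is_transversal T \<longleftrightarrow> finite T \<and> card T = q \<and> (\<forall>t\<in>T. v t \<le> 1) \<and>
     (\<forall>x. v x \<le> 1 \<longrightarrow> (\<exists>t\<in>T. v (x - t) < 1)) \<and>
     (\<forall>s\<in>T. \<forall>t\<in>T. v (s - t) < 1 \<longrightarrow> s = t)"

lemma transversalD:
  assumes "is_transversal T"
  shows "finite T" "card T = q" "\<And>t. t \<in> T \<Longrightarrow> v t \<le> 1"
    and "\<And>x. v x \<le> 1 \<Longrightarrow> \<exists>t\<in>T. v (x - t) < 1"
    and "\<And>s t. s \<in> T \<Longrightarrow> t \<in> T \<Longrightarrow> v (s - t) < 1 \<Longrightarrow> s = t"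
  using assms by (simp_all add: is_transversal_def)

lemma ex_transversal: "\<exists>T. is_transversal T"
proof -
  have eqv: "equiv (val_ring v) (residue_rel v)"
  proof (intro equivI refl_onI symI transI)
    show "(x, z) \<in> residue_rel v" if "(x, y) \<in> residue_rel v" "(y, z) \<in> residue_rel v" for x y z
      using that v_triangle_less[of x y 1 z] by (auto simp: residue_rel_def)
  qed (auto simp: residue_rel_def val_ring_def v_minus_commute)
  have fin: "finite (residue_field v)"
    using local_field unfolding local_field_def by blast
  define rep where "rep C = (SOME x. x \<in> C)" for C :: "'k set"
  have rep: "rep C \<in> C" if "C \<in> residue_field v" for C
    using that in_quotient_imp_non_empty[OF eqv] unfolding rep_def residue_field_def
    by (simp add: some_in_eq)
  have inj: "C = D" if "C \<in> residue_field v" "D \<in> residue_field v" "v (rep C - rep D) < 1" for C D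
  proof -
    have "(rep C, rep D) \<in> residue_rel v"
      using that rep in_quotient_imp_subset[OF eqv] unfolding residue_field_def residue_rel_def by blast
    then show ?thesis
      using quotient_eqI[OF eqv] that rep unfolding residue_field_def by blast
  qed
  have le: "v (rep C) \<le> 1" if "C \<in> residue_field v" for C
    using rep[OF that] that in_quotient_imp_subset[OF eqv]
    unfolding residue_field_def val_ring_def by blast
  have ex: "\<exists>t. t \<in> rep ` residue_field v \<and> v (x - t) < 1" if "v x \<le> 1" for x
  proof -
    define C where "C = residue_rel v `` {x}"
    have "C \<in> residue_field v"
      using that unfolding C_def residue_field_def val_ring_def by (simp add: quotientI)
    moreover have "v (x - rep C) < 1"
      using rep[OF calculation] unfolding C_def residue_rel_def by auto
    ultimately show ?thesis by blast
  qed
  have "is_transversal (rep ` residue_field v)"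
    unfolding is_transversal_def
  proof (intro conjI ballI allI impI)
    show "finite (rep ` residue_field v)"
      using fin by simp
    show "card (rep ` residue_field v) = q"
      unfolding q_eq by (rule card_image, rule inj_onI, rule inj) auto
    show "v t \<le> 1" if "t \<in> rep ` residue_field v" for t
      using le that by blast
    show "\<exists>t\<in>rep ` residue_field v. v (x - t) < 1" if "v x \<le> 1" for x
      using ex[OF that] by blast
    show "s = t" if "s \<in> rep ` residue_field v" "t \<in> rep ` residue_field v" "v (s - t) < 1" for s t
      using inj that by auto
  qed
  then show ?thesis ..
qed

text \<open>Translation by 1 permutes the residue classes. Summing t + 1 - f t over all
  representatives, with \<open>f t\<close> the representative of t + 1, cancels everything except q
  copies of 1, and each summand lies in the maximal ideal.\<close>

lemma v_of_nat_q_less: "v (of_nat q) < 1"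
proof -
  obtain T where "is_transversal T"
    using ex_transversal ..
  note T = transversalD(1-3)[OF this] and reps = transversalD(4)[OF this] and T_eq = transversalD(5)[OF this]
  have "\<forall>t\<in>T. \<exists>s\<in>T. v (t + 1 - s) < 1"
    using T(3) by (auto intro!: reps v_add_le)
  then obtain f where f: "\<And>t. t \<in> T \<Longrightarrow> f t \<in> T \<and> v (t + 1 - f t) < 1"
    by metis
  have "inj_on f T"
  proof
    fix s t assume st: "s \<in> T" "t \<in> T" "f s = f t"
    then have "v (s + 1 - (t + 1)) < 1"
      using f v_triangle_less[of "s + 1" "f s" 1 "t + 1"] v_minus_commute by metis
    then have "v (s - t) < 1"
      by simp
    then show "s = t"
      using T_eq st by blast
  qed
  moreover have "f ` T \<subseteq> T"
    using f by blast
  ultimately have "sum f T = \<Sum> T"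
    using T(1) endo_inj_surj[of T f] sum.reindex[of f T id] by simp
  then have "(\<Sum>t\<in>T. t + 1 - f t) = of_nat q"
    using T(2) by (simp add: sum_subtractf sum.distrib)
  moreover have "v (\<Sum>t\<in>T. t + 1 - f t) < 1"
    using f by (intro v_sum_less) auto
  ultimately show ?thesis by simp
qed

lemma q_ge_2: "2 \<le> q"
proof -
  obtain T where "is_transversal T"
    using ex_transversal ..
  note T = transversalD(1-3)[OF this] and reps = transversalD(4)[OF this] and T_eq = transversalD(5)[OF this]
  obtain s where s: "s \<in> T" "v (0 - s) < 1"
    using reps[of 0] by auto
  obtain t where t: "t \<in> T" "v (1 - t) < 1"
    using reps[of 1] by auto
  have "v s \<noteq> v t"
    using s t v_eq_1_cong[of t 1] v_minus_commute[of 1 t] by simp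
  then have "s \<noteq> t"
    by blast
  then have "card {s, t} \<le> card T"
    using s t T by (intro card_mono) auto
  then show ?thesis
    using \<open>s \<noteq> t\<close> T by simp
qed

text \<open>Fermat's little theorem for the residue field. Multiplication by a unit \<open>x\<close>
  permutes the nonzero classes, so the product of their representatives changes by the factor
  x^(q-1) but stays the same modulo the maximal ideal.\<close>

lemma v_power_q_diff_less:
  assumes x: "v x \<le> 1"
  shows "v (x ^ q - x) < 1"
proof (cases "v x < 1")
  case True
  then have "v (x ^ q) < 1"
    using q_ge_2 by (simp add: v_power power_Suc_less_one power_less_one_iff)
  then show ?thesis
    using True v_diff[of "x ^ q" x] by simp
next
  case False
  with x have vx: "v x = 1" by simp
  obtain T where "is_transversal T"
    using ex_transversal ..
  note T = transversalD(1-3)[OF this] and reps = transversalD(4)[OF this] and T_eq = transversalD(5)[OF this]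
  obtain z where z: "z \<in> T" "v (0 - z) < 1"
    using reps[of 0] by auto
  define U where "U = T - {z}"
  have U: "v t = 1" if "t \<in> U" for t
  proof (rule ccontr)
    assume "v t \<noteq> 1"
    then have "v (z - t) < 1"
      using T(3)[of t] z(2) v_diff[of z t] that unfolding U_def by auto
    then show False
      using T_eq z that unfolding U_def by blast
  qed
  have "\<forall>t\<in>T. \<exists>s\<in>T. v (x * t - s) < 1"
    using T(3) v_mult_le_1[OF x] by (auto intro!: reps)
  then obtain f where f: "\<And>t. t \<in> T \<Longrightarrow> f t \<in> T \<and> v (x * t - f t) < 1"
    by metis
  have f_unit: "v (f t) = 1" if "t \<in> U" for t
    using f[of t] that U v_eq_1_cong[of "f t" "x * t"] unfolding U_def
    by (metis DiffD1 mult_1 v_minus_commute v_mult vx)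
  have "inj_on f U"
  proof
    fix s t assume st: "s \<in> U" "t \<in> U" "f s = f t"
    then have "v (x * s - x * t) < 1"
      using f v_triangle_less[of "x * s" "f s" 1 "x * t"] v_minus_commute unfolding U_def by (metis DiffD1)
    then have "v (s - t) < 1"
      using v_mult[of x "s - t"] vx by (simp add: right_diff_distrib)
    then show "s = t"
      using T_eq st unfolding U_def by blast
  qed
  moreover have "f ` U \<subseteq> U"
    using f f_unit z unfolding U_def by force
  ultimately have "prod f U = \<Prod> U"
    using T(1) endo_inj_surj[of U f] prod.reindex[of f U id] unfolding U_def by simp
  moreover have "card U = q - 1"
    using T z unfolding U_def by simp
  ultimately have "(\<Prod>t\<in>U. x * t) - prod f U = (x ^ (q - 1) - 1) * \<Prod> U"
    by (simp add: prod.distrib algebra_simps)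
  moreover have "v ((\<Prod>t\<in>U. x * t) - prod f U) < 1"
    using f f_unit U by (intro v_prod_cong) (auto simp: v_mult vx U_def)
  moreover have "v (\<Prod> U) = 1"
    using U by (simp add: v_prod)
  ultimately have "v (x ^ (q - 1) - 1) < 1"
    by (simp add: v_mult)
  then have "v (x * (x ^ (q - 1) - 1)) < 1"
    by (simp add: v_mult vx)
  moreover have "x * (x ^ (q - 1) - 1) = x ^ q - x"
    using q_ge_2 by (simp add: right_diff_distrib flip: power_Suc)
  ultimately show ?thesis by simp
qed

text \<open>The gain of a factor \<open>v \<pi>\<close> comes from the vanishing of \<open>q\<close> in the residue field.\<close>
lemma v_power_q_diff_le:
  assumes "v x \<le> 1" "v y \<le> 1" "v (x - y) < 1"
  shows "v (x ^ q - y ^ q) \<le> v unif * v (x - y)"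
proof -
  define S where "S = (\<Sum>i<q. y ^ (q - Suc i) * x ^ i)"
  have eq: "x ^ q - y ^ q = (x - y) * S"
    unfolding S_def by (simp add: power_diff_sumr2)
  have "v (y ^ (q - Suc i) * x ^ i - y ^ (q - 1)) < 1" if "i < q" for i
  proof -
    have "v (x ^ n - y ^ n) < 1" for n
      using v_prod_cong[of "{..<n}" "\<lambda>_. x" "\<lambda>_. y"] assms by simp
    then have "v (y ^ (q - Suc i) * (x ^ i - y ^ i)) < 1"
      by (intro v_mult_less_1 v_power_le_1 assms)
    moreover have "y ^ (q - Suc i) * y ^ i = y ^ (q - 1)"
      using that by (simp flip: power_add)
    ultimately show ?thesis
      by (simp add: right_diff_distrib)
  qed
  then have "v (\<Sum>i<q. y ^ (q - Suc i) * x ^ i - y ^ (q - 1)) < 1"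
    by (intro v_sum_less) auto
  moreover have "v (y ^ (q - 1) * of_nat q) < 1"
    by (intro v_mult_less_1 v_power_le_1 assms v_of_nat_q_less)
  moreover have "S = (\<Sum>i<q. y ^ (q - Suc i) * x ^ i - y ^ (q - 1)) + of_nat q * y ^ (q - 1)"
    by (simp add: S_def sum_subtractf)
  ultimately have "v S < 1"
    using v_add[of "\<Sum>i<q. y ^ (q - Suc i) * x ^ i - y ^ (q - 1)" "of_nat q * y ^ (q - 1)"]
    by (simp add: mult.commute)
  then show ?thesis
    unfolding eq v_mult using v_le_v_unif[of S] by (simp add: mult.commute mult_right_mono)
qed

section \<open>The roots of X^q - X\<close>

definition teich :: "'k set"
  where "teich = {t. t ^ q = t}"

lemma zero_in_teich [simp]: "0 \<in> teich"
  using q_ge_2 by (simp add: teich_def)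

lemma v_teich_le: "t \<in> teich \<Longrightarrow> v t \<le> 1"
proof -
  assume t: "t \<in> teich"
  show "v t \<le> 1"
  proof (rule ccontr)
    assume "\<not> v t \<le> 1"
    then have "v t ^ 1 < v t ^ q"
      using q_ge_2 by (intro power_strict_increasing) auto
    then show False
      using t by (simp add: teich_def flip: v_power)
  qed
qed

text \<open>On roots the map x -> x^q is the identity, yet on a residue class it contracts distances
  by the factor \<open>v unif < 1\<close>.\<close>

lemma teich_cong_eq:
  assumes "s \<in> teich" "t \<in> teich" "v (s - t) < 1"
  shows "s = t"
proof (rule ccontr)
  assume "s \<noteq> t"
  have "v (s ^ q - t ^ q) \<le> v unif * v (s - t)"
    using assms v_teich_le by (intro v_power_q_diff_le) auto
  then have "v (s - t) \<le> v unif * v (s - t)"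
    using assms by (simp add: teich_def)
  then show False
    using v_unif_less_1 \<open>s \<noteq> t\<close> by simp
qed

text \<open>The root is the limit of the iterates x^(q^n). The q-th power map contracts each residue
  class, so the steps decay like powers of \<open>v unif\<close>, the iterates stay in the class of
  \<open>x\<close>, and the limit is a fixed point.\<close>

lemma ex_teich:
  assumes x: "v x \<le> 1"
  shows "\<exists>t\<in>teich. v (x - t) < 1"
proof -
  define X where "X n = x ^ q ^ n" for n
  have X_le: "v (X n) \<le> 1" for n
    unfolding X_def using x by (rule v_power_le_1)
  have step: "v (X (Suc n) - X n) \<le> v unif ^ Suc n" for n
  proof (induction n)
    case 0
    then show ?case
      using v_le_v_unif[OF v_power_q_diff_less[OF x]] by (simp add: X_def)
  next
    case (Suc n)
    have "v unif ^ Suc n < 1"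
      using v_unif_less_1 by (intro power_Suc_less_one) auto
    then have "v (X (Suc n) ^ q - X n ^ q) \<le> v unif * v (X (Suc n) - X n)"
      using Suc by (intro v_power_q_diff_le X_le) auto
    moreover have "X k ^ q = X (Suc k)" for k
      by (simp add: X_def mult.commute flip: power_mult)
    ultimately have "v (X (Suc (Suc n)) - X (Suc n)) \<le> v unif * v (X (Suc n) - X n)"
      by simp
    also have "\<dots> \<le> v unif * v unif ^ Suc n"
      using Suc by (intro mult_left_mono) auto
    finally show ?case
      by simp
  qed
  have small: "\<exists>N. \<forall>n\<ge>N. v (X (Suc n) - X n) \<le> e" if e: "0 < e" for e
  proof -
    obtain N where N: "v unif ^ N < e"
      using ex_unif_power_less[OF e] by blast
    have "v (X (Suc n) - X n) \<le> e" if "n \<ge> N" for n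
      using step[of n] N power_decreasing[of N "Suc n" "v unif"] that v_unif_less_1 by simp
    then show ?thesis by blast
  qed
  obtain t where t: "v_converges v X t"
    using converges_if_steps_small[OF small] by blast
  have near: "v (X n - x) \<le> v unif" for n
  proof (induction n)
    case (Suc n)
    have "v unif ^ Suc n \<le> v unif ^ 1"
      using v_unif_less_1 by (intro power_decreasing) auto
    then have "v (X (Suc n) - X n) \<le> v unif"
      unfolding power_one_right using step order_trans by blast
    then show ?case
      using Suc v_triangle by blast
  qed (simp add: X_def)
  have tx: "v (t - x) \<le> v unif"
    using v_limit_le[OF t] near by blast
  have t_le: "v t \<le> 1"
    using v_add_le[of "t - x" 1 x] tx x v_unif_less_1 by simp
  have "t ^ q = t"
  proof (rule eq_if_v_diff_small)
    fix e :: real assume "0 < e"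
    then obtain N where N: "\<And>n. n \<ge> N \<Longrightarrow> v (X n - t) < min e 1"
      using t unfolding v_converges_def by (metis min_less_iff_conj zero_less_one)
    have "v (X (Suc N) - t ^ q) \<le> v unif * v (X N - t)"
      using v_power_q_diff_le[OF X_le[of N] t_le] N[of N]
      by (simp add: X_def mult.commute flip: power_mult)
    also have "\<dots> \<le> 1 * v (X N - t)"
      using v_unif_less_1 by (intro mult_right_mono) auto
    finally have "v (t ^ q - X (Suc N)) \<le> e"
      using N[of N] v_minus_commute by simp
    moreover have "v (X (Suc N) - t) \<le> e"
      using N[of "Suc N"] by simp
    ultimately show "v (t ^ q - t) \<le> e"
      by (rule v_triangle)
  qed
  then show ?thesis
    using tx v_unif_less_1 v_minus_commute by (force simp: teich_def)
qed

text \<open>Each residue class contains exactly one root, so sending a representative to the root in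
  its class is a bijection.\<close>

lemma card_teich: "card teich = q"
proof -
  obtain T where "is_transversal T"
    using ex_transversal ..
  note T = transversalD(1-3)[OF this] and reps = transversalD(4)[OF this] and T_eq = transversalD(5)[OF this]
  have "\<forall>t\<in>T. \<exists>s\<in>teich. v (t - s) < 1"
    by (intro ballI ex_teich T(3))
  then obtain f where f: "\<And>t. t \<in> T \<Longrightarrow> f t \<in> teich" "\<And>t. t \<in> T \<Longrightarrow> v (t - f t) < 1"
    unfolding bchoice_iff Bex_def by auto
  have "bij_betw f T teich"
    unfolding bij_betw_def
  proof
    show "inj_on f T"
    proof
      fix s t assume st: "s \<in> T" "t \<in> T" "f s = f t"
      then have "v (s - t) < 1"
        using f(2)[of s] f(2)[of t] v_triangle_less[of s "f s" 1 t] v_minus_commute[of t "f t"] by simp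
      then show "s = t"
        using T_eq st by blast
    qed
    show "f ` T = teich"
    proof
      show "teich \<subseteq> f ` T"
      proof
        fix t assume t: "t \<in> teich"
        then obtain s where s: "s \<in> T" "v (t - s) < 1"
          using reps[OF v_teich_le] by auto
        then have "t = f s"
          using teich_cong_eq[OF t f(1)] f(2)[of s] v_triangle_less[of t s 1 "f s"] by simp
        then show "t \<in> f ` T"
          using s by blast
      qed
      show "f ` T \<subseteq> teich"
        using f by blast
    qed
  qed
  then show ?thesis
    using T(2) bij_betw_same_card[of f T teich] by simp
qed

lemma finite_teich [simp]: "finite teich"
  using card_teich q_ge_2 by (intro card_ge_0_finite) simp

end

section \<open>Evaluation of restricted series\<close>

abbreviation "lookup \<equiv> Poly_Mapping.lookup"
abbreviation "keys \<equiv> Poly_Mapping.keys"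
abbreviation "single \<equiv> Poly_Mapping.single"

section \<open>Evaluation of polynomials in countably many variables\<close>

definition monom_val :: "(nat \<Rightarrow> 'k::field) \<Rightarrow> (nat \<Rightarrow>\<^sub>0 nat) \<Rightarrow> 'k"
  where "monom_val a m = (\<Prod>j\<in>keys m. a j ^ lookup m j)"

lemma monom_val_superset:
  "finite S \<Longrightarrow> keys m \<subseteq> S \<Longrightarrow> monom_val a m = (\<Prod>j\<in>S. a j ^ lookup m j)"
  unfolding monom_val_def by (rule prod.mono_neutral_left) (auto simp: in_keys_iff)

lemma monom_val_add: "monom_val a (m + n) = monom_val a m * monom_val a n"
proof -
  have "monom_val a k = (\<Prod>j\<in>keys m \<union> keys n. a j ^ lookup k j)" if "k \<in> {m, n, m + n}" for k
    using that Poly_Mapping.keys_add[of m n] by (intro monom_val_superset) auto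
  then show ?thesis
    by (simp add: lookup_add power_add prod.distrib)
qed

lemma monom_val_0 [simp]: "monom_val a 0 = 1"
  by (simp add: monom_val_def)

lemma monom_val_single [simp]: "monom_val a (single j n) = a j ^ n"
  by (cases "n = 0") (simp_all add: monom_val_def)

definition poly_val :: "(nat \<Rightarrow> 'k::field) \<Rightarrow> ((nat \<Rightarrow>\<^sub>0 nat) \<Rightarrow>\<^sub>0 'k) \<Rightarrow> 'k"
  where "poly_val a p = (\<Sum>m\<in>keys p. lookup p m * monom_val a m)"

lemma poly_val_superset:
  "finite S \<Longrightarrow> keys p \<subseteq> S \<Longrightarrow> poly_val a p = (\<Sum>m\<in>S. lookup p m * monom_val a m)"
  unfolding poly_val_def by (rule sum.mono_neutral_left) (auto simp: in_keys_iff)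

lemma poly_val_0 [simp]: "poly_val a 0 = 0"
  by (simp add: poly_val_def)

lemma poly_val_single [simp]: "poly_val a (single m c) = c * monom_val a m"
  by (cases "c = 0") (simp_all add: poly_val_def)

lemma poly_val_1 [simp]: "poly_val a 1 = 1"
  unfolding single_one[symmetric] by (simp del: single_one)

lemma poly_val_add: "poly_val a (p + r) = poly_val a p + poly_val a r"
proof -
  have "poly_val a s = (\<Sum>m\<in>keys p \<union> keys r. lookup s m * monom_val a m)" if "s \<in> {p, r, p + r}" for s
    using that Poly_Mapping.keys_add[of p r] by (intro poly_val_superset) auto
  then show ?thesis
    by (simp add: lookup_add distrib_right sum.distrib)
qed

lemma poly_val_uminus: "poly_val a (- p) = - poly_val a p"
  by (simp add: poly_val_def sum_negf)

lemma poly_val_diff: "poly_val a (p - r) = poly_val a p - poly_val a r"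
  using poly_val_add[of a p "- r"] by (simp add: poly_val_uminus)

lemma poly_val_sum: "poly_val a (sum f A) = (\<Sum>i\<in>A. poly_val a (f i))"
  by (induction A rule: infinite_finite_induct) (simp_all add: poly_val_add)

lemma sum_single_lookup: "(\<Sum>m\<in>keys p. single m (lookup p m)) = p"
  by (rule poly_mapping_eqI) (simp add: lookup_sum lookup_single when_def in_keys_iff)

lemma mult_eq_sum_single:
  fixes p r :: "(nat \<Rightarrow>\<^sub>0 nat) \<Rightarrow>\<^sub>0 'k::field"
  shows "p * r = (\<Sum>m\<in>keys p. \<Sum>n\<in>keys r. single (m + n) (lookup p m * lookup r n))"
proof -
  have "p * r = (\<Sum>m\<in>keys p. single m (lookup p m)) *
      (\<Sum>n\<in>keys r. single n (lookup r n))"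
    by (simp add: sum_single_lookup)
  then show ?thesis
    by (simp add: sum_product mult_single)
qed

lemma poly_val_mult: "poly_val a (p * r) = poly_val a p * poly_val a r"
proof -
  have "poly_val a (p * r) =
      (\<Sum>m\<in>keys p. \<Sum>n\<in>keys r. (lookup p m * lookup r n) * monom_val a (m + n))"
    by (simp add: mult_eq_sum_single poly_val_sum)
  also have "\<dots> = poly_val a p * poly_val a r"
    unfolding poly_val_def sum_product by (simp add: monom_val_add mult_ac)
  finally show ?thesis .
qed

lemma poly_val_prod: "poly_val a (prod f A) = (\<Prod>i\<in>A. poly_val a (f i))"
  by (induction A rule: infinite_finite_induct) (simp_all add: poly_val_mult)

text \<open>This gives the sum in \<open>rs_mult\<close> its intended meaning, since sums over
  infinite sets are 0 by convention. A first component is dominated by \<open>m\<close> and vanishes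
  off its support, which leaves finitely many; it determines the second component by
  cancellation.\<close>

lemma finite_add_fiber: "finite {p :: (nat \<Rightarrow>\<^sub>0 nat) \<times> (nat \<Rightarrow>\<^sub>0 nat). fst p + snd p = m}"
proof -
  define D where "D = {f :: nat \<Rightarrow> nat. \<forall>j. (j \<in> keys m \<longrightarrow> f j \<in> {..Max (range (lookup m))}) \<and>
    (j \<notin> keys m \<longrightarrow> f j = 0)}"
  have "finite D"
    unfolding D_def by (rule finite_set_of_finite_funs) auto
  have fin: "finite (range (lookup m))"
    by (rule finite_subset[of _ "insert 0 (lookup m ` keys m)"]) (auto simp: in_keys_iff)
  have le: "lookup n j \<le> lookup m j" if "n + k = m" for n k j
    using that by (auto simp: lookup_add)
  have "lookup n \<in> D" if "n + k = m" for n k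
    unfolding D_def
  proof (intro CollectI allI conjI impI)
    fix j
    show "lookup n j \<in> {..Max (range (lookup m))}"
      using le[OF that, of j] Max_ge[OF fin, of "lookup m j"] by simp
    show "lookup n j = 0" if "j \<notin> keys m"
      using le[OF \<open>n + k = m\<close>, of j] that by (simp add: in_keys_iff)
  qed
  then have "fst ` {p. fst p + snd p = m} \<subseteq> lookup -` D"
    by auto
  moreover have "finite (lookup -` D)"
    using \<open>finite D\<close> by (rule finite_vimageI) (auto intro: injI poly_mapping_eqI)
  ultimately have "finite (fst ` {p. fst p + snd p = m})"
    by (rule finite_subset)
  then show ?thesis
    by (rule finite_imageD) (auto intro!: inj_onI prod_eqI)
qed

lemma rs_mult_lookup: "rs_mult (lookup p) (lookup r) = lookup (p * r)"
proof
  fix m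
  define F where "F = {x :: (nat \<Rightarrow>\<^sub>0 nat) \<times> (nat \<Rightarrow>\<^sub>0 nat). fst x + snd x = m}"
  have "rs_mult (lookup p) (lookup r) m = (\<Sum>x\<in>F. lookup p (fst x) * lookup r (snd x))"
    by (simp add: rs_mult_def F_def)
  also have "\<dots> = (\<Sum>x\<in>F \<inter> (keys p \<times> keys r). lookup p (fst x) * lookup r (snd x))"
    using finite_add_fiber[of m]
    by (intro sum.mono_neutral_right) (auto simp: in_keys_iff F_def)
  also have "F \<inter> (keys p \<times> keys r) = {x \<in> keys p \<times> keys r. fst x + snd x = m}"
    by (auto simp: F_def)
  also have "(\<Sum>x\<in>\<dots>. lookup p (fst x) * lookup r (snd x)) =
      (\<Sum>x\<in>keys p \<times> keys r. if fst x + snd x = m then lookup p (fst x) * lookup r (snd x) else 0)"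
    by (rule sum.inter_filter) simp
  also have "\<dots> = lookup (p * r) m"
    by (simp add: mult_eq_sum_single lookup_sum lookup_single when_def sum.cartesian_product
        case_prod_beta)
  finally show "rs_mult (lookup p) (lookup r) m = lookup (p * r) m" .
qed

lemma rs_mult_diff_left: "rs_mult (f - g) h = rs_mult f h - rs_mult g h"
  by (rule ext) (simp add: rs_mult_def left_diff_distrib sum_subtractf)

lemma rs_mult_diff_right: "rs_mult f (g - h) = rs_mult f g - rs_mult f h"
  by (rule ext) (simp add: rs_mult_def right_diff_distrib sum_subtractf)

lemma rs_one_eq: "rs_one = lookup 1"
  by (rule ext) (simp add: rs_one_def lookup_one when_def)

section \<open>Coefficient bounds and density of the polynomials\<close>

context nonarch_field
begin

text \<open>Estimates are stated through explicit bounds because \<open>rs_norm\<close> is a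
  supremum that means something only for a bounded family; the two are linked by
  \<open>rs_norm_le\<close> and \<open>bounded_by_rs_norm\<close>.\<close>

definition bounded_by :: "('i \<Rightarrow> 'k) \<Rightarrow> real \<Rightarrow> bool"
  where "bounded_by f c \<longleftrightarrow> (\<forall>i. v (f i) \<le> c)"

lemma bounded_byD: "bounded_by f c \<Longrightarrow> v (f i) \<le> c"
  by (simp add: bounded_by_def)

lemma bounded_by_nonneg: "bounded_by f c \<Longrightarrow> 0 \<le> c"
  using bounded_byD[of f c undefined] v_nonneg[of "f undefined"] by linarith

lemma bounded_by_mono: "bounded_by f c \<Longrightarrow> c \<le> d \<Longrightarrow> bounded_by f d"
  by (simp add: bounded_by_def order_trans[of _ c d])

lemma bounded_by_add: "bounded_by f c \<Longrightarrow> bounded_by g c \<Longrightarrow> bounded_by (f + g) c"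
  by (simp add: bounded_by_def v_add_le)

lemma bounded_by_diff: "bounded_by f c \<Longrightarrow> bounded_by g c \<Longrightarrow> bounded_by (f - g) c"
  by (simp add: bounded_by_def v_diff_le)

lemma bounded_by_triangle: "bounded_by (f - g) c \<Longrightarrow> bounded_by (g - h) c \<Longrightarrow> bounded_by (f - h) c"
  using bounded_by_add[of "f - g" c "g - h"] by simp

lemma bounded_by_rs_mult:
  assumes "bounded_by f c" "bounded_by g d"
  shows "bounded_by (rs_mult f g) (c * d)"
  unfolding bounded_by_def rs_mult_def
proof
  fix m
  show "v (\<Sum>p\<in>{p. fst p + snd p = m}. f (fst p) * g (snd p)) \<le> c * d"
    using assms bounded_by_nonneg[OF assms(1)] bounded_by_nonneg[OF assms(2)]
    by (intro v_sum_le) (auto simp: v_mult bounded_by_def intro: mult_mono)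
qed

lemma bounded_by_mult:
  fixes p r :: "(nat \<Rightarrow>\<^sub>0 nat) \<Rightarrow>\<^sub>0 'k"
  assumes "bounded_by (lookup p) c" "bounded_by (lookup r) d"
  shows "bounded_by (lookup (p * r)) (c * d)"
  using bounded_by_rs_mult[OF assms] by (simp add: rs_mult_lookup)

lemma bounded_by_lookup_sum:
  assumes "\<And>i. i \<in> A \<Longrightarrow> bounded_by (lookup (f i)) c" "0 \<le> c"
  shows "bounded_by (lookup (sum f A)) c"
  using assms by (simp add: bounded_by_def lookup_sum v_sum_le)

lemma bounded_by_prod:
  fixes f :: "'i \<Rightarrow> (nat \<Rightarrow>\<^sub>0 nat) \<Rightarrow>\<^sub>0 'k"
  assumes "\<And>i. i \<in> A \<Longrightarrow> bounded_by (lookup (f i)) 1"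
  shows "bounded_by (lookup (prod f A)) 1"
  using assms
proof (induction A rule: infinite_finite_induct)
  case (insert x A)
  then show ?case
    using bounded_by_mult[of "f x" 1 "prod f A" 1] by simp
qed (simp_all add: bounded_by_def lookup_one when_def)

lemma rs_norm_le: "bounded_by f c \<Longrightarrow> rs_norm v f \<le> c"
  unfolding rs_norm_def by (rule cSUP_least) (auto simp: bounded_by_def)

lemma bounded_by_rs_norm:
  assumes "f \<in> restricted v"
  shows "bounded_by f (rs_norm v f)"
proof -
  have "finite {m. 1 \<le> v (f m)}"
    using assms by (simp add: restricted_def)
  then have "bdd_above ((\<lambda>m. v (f m)) ` {m. 1 \<le> v (f m)} \<union> {..1})"
    by (simp add: bdd_above_finite)
  then have "bdd_above (range (\<lambda>m. v (f m)))"
    by (rule bdd_above_mono) (auto simp: image_iff not_le intro: less_imp_le)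
  then show ?thesis
    unfolding bounded_by_def rs_norm_def by (auto intro: cSUP_upper)
qed

text \<open>Truncation: the coefficients of value at least \<open>e\<close> are finitely many and
  form the polynomial.\<close>

lemma restricted_approx:
  assumes "f \<in> restricted v" "0 < e"
  obtains p where "bounded_by (f - lookup p) e"
proof
  have "finite {m. (if e \<le> v (f m) then f m else 0) \<noteq> 0}"
    by (rule finite_subset[of _ "{m. e \<le> v (f m)}"]) (use assms in \<open>auto simp: restricted_def\<close>)
  then have "lookup (Abs_poly_mapping (\<lambda>m. if e \<le> v (f m) then f m else 0)) =
      (\<lambda>m. if e \<le> v (f m) then f m else 0)"
    by (intro Abs_poly_mapping_inverse) simp
  then show "bounded_by (f - lookup (Abs_poly_mapping (\<lambda>m. if e \<le> v (f m) then f m else 0))) e"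
    using assms(2) by (auto simp: bounded_by_def)
qed

lemma restrictedI:
  assumes "\<And>e. 0 < e \<Longrightarrow> \<exists>p. bounded_by (f - lookup p) e"
  shows "f \<in> restricted v"
  unfolding restricted_def
proof (intro CollectI allI impI)
  fix e :: real assume "0 < e"
  \<comment> \<open>With error e / 2, a coefficient of value at least \<open>e\<close> cannot sit
    outside the support of \<open>p\<close>; error \<open>e\<close> would leave the boundary case
    open.\<close>
  then obtain p where p: "bounded_by (f - lookup p) (e / 2)"
    using assms[of "e / 2"] by auto
  have "m \<in> keys p" if "e \<le> v (f m)" for m
    using bounded_byD[OF p, of m] that \<open>0 < e\<close> by (auto simp: in_keys_iff)
  then have "{m. e \<le> v (f m)} \<subseteq> keys p"
    by blast
  then show "finite {m. e \<le> v (f m)}"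
    by (rule finite_subset) simp
qed

lemma lookup_restricted [simp]: "lookup p \<in> restricted v"
  by (rule restrictedI, rule exI[of _ p]) (simp add: bounded_by_def)

lemma restricted_add:
  assumes "f \<in> restricted v" "g \<in> restricted v"
  shows "f + g \<in> restricted v"
proof (rule restrictedI)
  fix e :: real assume "0 < e"
  obtain p where p: "bounded_by (f - lookup p) e"
    using restricted_approx[OF assms(1) \<open>0 < e\<close>] .
  obtain r where r: "bounded_by (g - lookup r) e"
    using restricted_approx[OF assms(2) \<open>0 < e\<close>] .
  have "bounded_by (f + g - lookup (p + r)) e"
    using bounded_by_add[OF p r]
    by (simp add: bounded_by_def lookup_add algebra_simps)
  then show "\<exists>s. bounded_by (f + g - lookup s) e" ..
qed

lemma restricted_smult:
  assumes "f \<in> restricted v"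
  shows "rs_smult c f \<in> restricted v"
  unfolding restricted_def
proof (intro CollectI allI impI)
  fix e :: real assume "0 < e"
  show "finite {m. e \<le> v (rs_smult c f m)}"
  proof (cases "c = 0")
    case False
    then have "{m. e \<le> v (rs_smult c f m)} = {m. e / v c \<le> v (f m)}"
      by (auto simp: rs_smult_def v_mult field_simps)
    then show ?thesis
      using assms \<open>0 < e\<close> False by (simp add: restricted_def)
  qed (use \<open>0 < e\<close> in \<open>simp add: rs_smult_def\<close>)
qed

lemma restricted_diff:
  assumes "f \<in> restricted v" "g \<in> restricted v"
  shows "f - g \<in> restricted v"
proof -
  have "f + rs_smult (- 1) g = f - g"
    by (rule ext) (simp add: rs_smult_def)
  then show ?thesis
    using restricted_add[OF assms(1) restricted_smult[OF assms(2), of "- 1"]] by simp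
qed

text \<open>The splitting is fg - pr = (f - p)g + p(g - r). The extra \<open>min c\<close> keeps
  \<open>p\<close> within the bound \<open>c\<close> of \<open>f\<close>, which the second term
  needs.\<close>

lemma rs_mult_approx:
  assumes f: "bounded_by f c" and g: "bounded_by g c" and "0 < e"
    and p: "bounded_by (f - lookup p) (min c (e / c))"
    and r: "bounded_by (g - lookup r) (e / c)"
  shows "bounded_by (rs_mult f g - lookup (p * r)) e"
proof -
  have "0 \<le> c"
    using bounded_by_nonneg[OF f] .
  then have le: "c * (e / c) \<le> e" "e / c * c \<le> e"
    using \<open>0 < e\<close> by auto
  have "bounded_by (lookup p) c"
    using bounded_by_diff[OF f bounded_by_mono[OF p, of c]] by simp
  then have "bounded_by (rs_mult (lookup p) (g - lookup r)) e"
    by (rule bounded_by_mono[OF bounded_by_rs_mult[OF _ r] le(1)])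
  moreover have "bounded_by (f - lookup p) (e / c)"
    using p by (rule bounded_by_mono) simp
  then have "bounded_by (rs_mult (f - lookup p) g) e"
    by (rule bounded_by_mono[OF bounded_by_rs_mult[OF _ g] le(2)])
  ultimately show ?thesis
    unfolding rs_mult_diff_left rs_mult_diff_right rs_mult_lookup
    using bounded_by_triangle by blast
qed

lemma bounded_by_common:
  assumes "f \<in> restricted v" "g \<in> restricted v"
  obtains c where "0 < c" "bounded_by f c" "bounded_by g c"
proof (rule that[of "max 1 (max (rs_norm v f) (rs_norm v g))"])
  show "bounded_by f (max 1 (max (rs_norm v f) (rs_norm v g)))"
    by (rule bounded_by_mono[OF bounded_by_rs_norm[OF assms(1)]]) simp
  show "bounded_by g (max 1 (max (rs_norm v f) (rs_norm v g)))"
    by (rule bounded_by_mono[OF bounded_by_rs_norm[OF assms(2)]]) simp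
qed simp

lemma restricted_mult:
  assumes "f \<in> restricted v" "g \<in> restricted v"
  shows "rs_mult f g \<in> restricted v"
proof (rule restrictedI)
  fix e :: real assume e: "0 < e"
  obtain c where c: "0 < c" "bounded_by f c" "bounded_by g c"
    using bounded_by_common[OF assms] .
  obtain p where p: "bounded_by (f - lookup p) (min c (e / c))"
    using restricted_approx[OF assms(1), of "min c (e / c)"] c(1) e by auto
  obtain r where "bounded_by (g - lookup r) (e / c)"
    using restricted_approx[OF assms(2), of "e / c"] c(1) e by auto
  then show "\<exists>s. bounded_by (rs_mult f g - lookup s) e"
    using rs_mult_approx[OF c(2,3) e p] by blast
qed

definition unit_seq :: "(nat \<Rightarrow> 'k) \<Rightarrow> bool"
  where "unit_seq a \<longleftrightarrow> (\<forall>j. v (a j) \<le> 1)"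

lemma v_monom_val_le: "unit_seq a \<Longrightarrow> v (monom_val a m) \<le> 1"
  unfolding monom_val_def unit_seq_def by (intro v_prod_le_1 v_power_le_1) auto

lemma v_poly_val_le:
  assumes a: "unit_seq a" and p: "bounded_by (lookup p) c"
  shows "v (poly_val a p) \<le> c"
  unfolding poly_val_def
proof (rule v_sum_le)
  show "v (lookup p m * monom_val a m) \<le> c" for m
    using mult_mono[OF bounded_byD[OF p, of m] v_monom_val_le[OF a]] bounded_by_nonneg[OF p]
    by (simp add: v_mult)
qed (rule bounded_by_nonneg[OF p])

end

section \<open>Extension of evaluation to restricted series\<close>

context nonarch_local_field
begin

text \<open>Restricted series are the completion of the polynomials, so a series is evaluated by extending
  the 1-Lipschitz polynomial evaluation; no infinite sums are needed.\<close>

definition is_eval :: "(nat \<Rightarrow> 'k) \<Rightarrow> 'k rseries \<Rightarrow> 'k \<Rightarrow> bool"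
  where "is_eval a f L \<longleftrightarrow> (\<forall>p e. bounded_by (f - lookup p) e \<longrightarrow> v (L - poly_val a p) \<le> e)"

definition eval :: "(nat \<Rightarrow> 'k) \<Rightarrow> 'k rseries \<Rightarrow> 'k"
  where "eval a f = (THE L. is_eval a f L)"

lemma v_poly_val_diff_le:
  assumes "unit_seq a" "bounded_by (f - lookup p) e" "bounded_by (f - lookup r) e"
  shows "v (poly_val a p - poly_val a r) \<le> e"
proof -
  have "bounded_by (lookup (p - r)) e"
    using bounded_by_diff[OF assms(3,2)] by (simp add: bounded_by_def lookup_minus)
  then show ?thesis
    using v_poly_val_le[OF assms(1)] by (simp flip: poly_val_diff)
qed

text \<open>Polynomials \<open>P n\<close> within 1/(n+1) of \<open>f\<close> have values whose
  steps tend to 0, because evaluation at a point of the unit polydisc does not increase the norm.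
  Their limit is the value of \<open>f\<close>.\<close>

lemma ex_is_eval:
  assumes a: "unit_seq a" and f: "f \<in> restricted v"
  shows "\<exists>L. is_eval a f L"
proof -
  have "\<exists>p. bounded_by (f - lookup p) (inverse (real (Suc n)))" for n
  proof -
    obtain p where "bounded_by (f - lookup p) (inverse (real (Suc n)))"
      by (rule restricted_approx[OF f, of "inverse (real (Suc n))"]) auto
    then show ?thesis ..
  qed
  then obtain P where P: "\<And>n. bounded_by (f - lookup (P n)) (inverse (real (Suc n)))"
    by metis
  have P_le: "bounded_by (f - lookup (P n)) e" if "inverse (real (Suc N)) < e" "n \<ge> N" for n N e
  proof (rule bounded_by_mono[OF P])
    have "inverse (real (Suc n)) \<le> inverse (real (Suc N))"
      using that(2) by (intro le_imp_inverse_le) auto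
    then show "inverse (real (Suc n)) \<le> e"
      using that(1) by linarith
  qed
  have steps: "\<exists>N. \<forall>n\<ge>N. v (poly_val a (P (Suc n)) - poly_val a (P n)) \<le> e" if "0 < e" for e
  proof -
    obtain N where N: "inverse (real (Suc N)) < e"
      using reals_Archimedean[OF \<open>0 < e\<close>] by blast
    have "v (poly_val a (P (Suc n)) - poly_val a (P n)) \<le> e" if "n \<ge> N" for n
      using that by (intro v_poly_val_diff_le[OF a, of f] P_le[OF N]) auto
    then show ?thesis by blast
  qed
  obtain L where L: "v_converges v (\<lambda>n. poly_val a (P n)) L"
    using converges_if_steps_small[OF steps] .
  have "is_eval a f L"
    unfolding is_eval_def
  proof (intro allI impI)
    fix p e assume p: "bounded_by (f - lookup p) e"
    \<comment> \<open>Here \<open>e\<close> may be 0, whereas \<open>P n\<close> approximates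
      \<open>f\<close> only up to a positive error, so a slack \<open>d\<close> is carried along and
      removed at the end.\<close>
    have le: "v (L - poly_val a p) \<le> e + d" if "0 < d" for d
    proof -
      obtain N where N: "inverse (real (Suc N)) < e + d"
        using reals_Archimedean[of "e + d"] bounded_by_nonneg[OF p] \<open>0 < d\<close> by auto
      have "v (poly_val a (P n) - poly_val a p) \<le> e + d" if "n \<ge> N" for n
        using bounded_by_mono[OF p, of "e + d"] \<open>0 < d\<close>
        by (intro v_poly_val_diff_le[OF a, of f] P_le[OF N that]) auto
      then show ?thesis
        using v_limit_le[OF L] by blast
    qed
    show "v (L - poly_val a p) \<le> e"
      by (rule field_le_epsilon) (rule le)
  qed
  then show ?thesis ..
qed

text \<open>A candidate value \<open>M\<close> is tested against a single good polynomial for each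
  \<open>e\<close>, not against all of them. This is the working criterion behind
  \<open>eval_eqI\<close>, from which the homomorphism laws follow.\<close>

lemma is_eval_unique:
  assumes f: "f \<in> restricted v" and L: "is_eval a f L"
    and approx: "\<And>e. 0 < e \<Longrightarrow> \<exists>p. bounded_by (f - lookup p) e \<and> v (M - poly_val a p) \<le> e"
  shows "L = M"
proof (rule eq_if_v_diff_small)
  fix e :: real assume "0 < e"
  then obtain p where p: "bounded_by (f - lookup p) e" "v (M - poly_val a p) \<le> e"
    using approx by blast
  then have "v (L - poly_val a p) \<le> e"
    using L unfolding is_eval_def by blast
  then show "v (L - M) \<le> e"
    using p(2) v_triangle[of L "poly_val a p" e M] by (simp add: v_minus_commute)
qed

lemma is_eval_eval:
  assumes a: "unit_seq a" and f: "f \<in> restricted v"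
  shows "is_eval a f (eval a f)"
proof -
  obtain L where L: "is_eval a f L"
    using ex_is_eval[OF assms] ..
  have "M = L" if M: "is_eval a f M" for M
  proof (rule is_eval_unique[OF f M])
    fix e :: real assume "0 < e"
    obtain p where "bounded_by (f - lookup p) e"
      using restricted_approx[OF f \<open>0 < e\<close>] .
    then show "\<exists>p. bounded_by (f - lookup p) e \<and> v (L - poly_val a p) \<le> e"
      using L unfolding is_eval_def by blast
  qed
  then show ?thesis
    unfolding eval_def using L by (rule theI[rotated])
qed

lemma eval_approx:
  assumes "unit_seq a" "f \<in> restricted v" "bounded_by (f - lookup p) e"
  shows "v (eval a f - poly_val a p) \<le> e"
  using is_eval_eval[of a f, OF assms(1,2)] assms(3) unfolding is_eval_def by blast

lemma eval_eqI:
  assumes "unit_seq a" "f \<in> restricted v"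
    and "\<And>e. 0 < e \<Longrightarrow> \<exists>p. bounded_by (f - lookup p) e \<and> v (L - poly_val a p) \<le> e"
  shows "eval a f = L"
  using is_eval_unique[OF assms(2) is_eval_eval[of a f, OF assms(1,2)] assms(3)] .

lemma eval_lookup:
  assumes "unit_seq a"
  shows "eval a (lookup p) = poly_val a p"
  by (rule eval_eqI[OF assms], simp, rule exI[of _ p]) (simp add: bounded_by_def)

lemma v_eval_le:
  assumes "unit_seq a" "f \<in> restricted v" "bounded_by f c"
  shows "v (eval a f) \<le> c"
  using eval_approx[of a f 0 c, OF assms(1,2)] assms(3) by (simp add: bounded_by_def)

lemma eval_add:
  assumes a: "unit_seq a" and f: "f \<in> restricted v" and g: "g \<in> restricted v"
  shows "eval a (f + g) = eval a f + eval a g"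
proof (rule eval_eqI[OF a restricted_add[OF f g]])
  fix e :: real assume e: "0 < e"
  obtain p where p: "bounded_by (f - lookup p) e"
    using restricted_approx[OF f e] .
  obtain r where r: "bounded_by (g - lookup r) e"
    using restricted_approx[OF g e] .
  have "bounded_by (f + g - lookup (p + r)) e"
    using bounded_by_add[OF p r] by (simp add: bounded_by_def lookup_add algebra_simps)
  moreover have "v (eval a f + eval a g - poly_val a (p + r)) \<le> e"
    using v_add_le[OF eval_approx[OF a f p] eval_approx[OF a g r]]
    by (simp add: poly_val_add algebra_simps)
  ultimately show "\<exists>s. bounded_by (f + g - lookup s) e \<and> v (eval a f + eval a g - poly_val a s) \<le> e"
    by blast
qed

lemma eval_mult:
  assumes a: "unit_seq a" and f: "f \<in> restricted v" and g: "g \<in> restricted v"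
  shows "eval a (rs_mult f g) = eval a f * eval a g"
proof (rule eval_eqI[OF a restricted_mult[OF f g]])
  fix e :: real assume e: "0 < e"
  obtain c where c: "0 < c" "bounded_by f c" "bounded_by g c"
    using bounded_by_common[OF f g] .
  obtain p where p: "bounded_by (f - lookup p) (min c (e / c))"
    using restricted_approx[OF f, of "min c (e / c)"] c(1) e by auto
  obtain r where r: "bounded_by (g - lookup r) (e / c)"
    using restricted_approx[OF g, of "e / c"] c(1) e by auto
  have "bounded_by (lookup p) c"
    using bounded_by_diff[OF c(2) bounded_by_mono[OF p, of c]] by simp
  then have "v (poly_val a p) \<le> c"
    by (rule v_poly_val_le[OF a])
  then have "v (poly_val a p * (eval a g - poly_val a r)) \<le> c * (e / c)"
    unfolding v_mult using eval_approx[OF a g r] c(1) by (intro mult_mono) auto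
  moreover have "v ((eval a f - poly_val a p) * eval a g) \<le> (e / c) * c"
    unfolding v_mult using eval_approx[OF a f p] v_eval_le[OF a g c(3)] c(1) e
    by (intro mult_mono) auto
  ultimately have "v (eval a f * eval a g - poly_val a (p * r)) \<le> e"
    using v_add_le[of "poly_val a p * (eval a g - poly_val a r)" e
        "(eval a f - poly_val a p) * eval a g"] c(1)
    by (simp add: poly_val_mult algebra_simps)
  then show "\<exists>s. bounded_by (rs_mult f g - lookup s) e \<and> v (eval a f * eval a g - poly_val a s) \<le> e"
    using rs_mult_approx[OF c(2,3) e p r] by blast
qed

lemma eval_smult:
  assumes a: "unit_seq a" and f: "f \<in> restricted v"
  shows "eval a (rs_smult c f) = c * eval a f"
\<comment> \<open>The approximation of \<open>f\<close> below has error \<open>e / v c\<close>,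
  which forces a separate treatment of 0.\<close>
proof (cases "c = 0")
  case True
  have "rs_smult c f = lookup 0"
    unfolding rs_smult_def True by (rule ext) simp
  then show ?thesis
    using True by (simp add: eval_lookup[OF a])
next
  case False
  show ?thesis
  proof (rule eval_eqI[OF a restricted_smult[OF f]])
    fix e :: real assume e: "0 < e"
    obtain p where p: "bounded_by (f - lookup p) (e / v c)"
      using restricted_approx[OF f, of "e / v c"] e False by auto
    define r where "r = Poly_Mapping.map ((*) c) p"
    have r: "lookup r m = c * lookup p m" for m
      by (simp add: r_def map.rep_eq when_def)
    have "keys r \<subseteq> keys p"
      by (auto simp: in_keys_iff r)
    then have "poly_val a r = c * poly_val a p"
      using poly_val_superset[of "keys p" r a]
      by (simp add: r poly_val_def sum_distrib_left mult.assoc)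
    then have "eval a f - poly_val a p = (c * eval a f - poly_val a r) / c"
      using False by (simp add: field_simps)
    then have "v (c * eval a f - poly_val a r) \<le> e"
      using eval_approx[OF a f p] False by (simp add: v_divide divide_le_cancel)
    moreover have "bounded_by (rs_smult c f - lookup r) e"
      unfolding bounded_by_def
    proof
      fix m
      have eq: "(rs_smult c f - lookup r) m = c * (f m - lookup p m)"
        by (simp add: rs_smult_def r right_diff_distrib)
      show "v ((rs_smult c f - lookup r) m) \<le> e"
        unfolding eq v_mult using bounded_byD[OF p, of m] False by (simp add: field_simps)
    qed
    ultimately show "\<exists>s. bounded_by (rs_smult c f - lookup s) e \<and> v (c * eval a f - poly_val a s) \<le> e"
      by blast
  qed
qed

lemma eval_diff:
  assumes a: "unit_seq a" and f: "f \<in> restricted v" and g: "g \<in> restricted v"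
  shows "eval a (f - g) = eval a f - eval a g"
  using eval_add[OF a restricted_diff[OF f g] g] by (simp add: algebra_simps)

end

section \<open>Interpolation at Teichmueller points\<close>

definition const_poly :: "'k \<Rightarrow> (nat \<Rightarrow>\<^sub>0 nat) \<Rightarrow>\<^sub>0 'k::field"
  where "const_poly c = single 0 c"

definition var_power :: "nat \<Rightarrow> nat \<Rightarrow> (nat \<Rightarrow>\<^sub>0 nat) \<Rightarrow>\<^sub>0 'k::field"
  where "var_power j i = single (single j i) 1"

lemma const_poly_add: "const_poly (c + d) = const_poly c + const_poly d"
  by (simp add: const_poly_def single_add)

lemma const_poly_diff: "const_poly (c - d) = const_poly c - const_poly d"
  by (simp add: const_poly_def single_diff)

lemma const_poly_mult: "const_poly (c * d) = const_poly c * const_poly d"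
  by (simp add: const_poly_def mult_single)

lemma const_poly_1: "const_poly 1 = 1"
  by (simp add: const_poly_def)

lemma var_power_mult: "var_power j i * var_power j k = var_power j (i + k)"
  by (simp add: var_power_def mult_single flip: single_add)

lemma var_power_0: "var_power j 0 = 1"
  by (simp add: var_power_def)

lemma var_power_power: "var_power j i ^ k = var_power j (i * k)"
  by (induction k) (simp_all add: var_power_0 var_power_mult add.commute)

lemma poly_val_const_poly [simp]: "poly_val a (const_poly c) = c"
  by (simp add: const_poly_def)

lemma poly_val_var_power [simp]: "poly_val a (var_power j i) = a j ^ i"
  by (simp add: var_power_def)

lemma single_eq_prod_var_power: "single m (1 :: 'k::field) = (\<Prod>j\<in>keys m. var_power j (lookup m j))"
proof -
  have "(\<Prod>j\<in>A. var_power j (lookup m j)) = single (\<Sum>j\<in>A. single j (lookup m j)) (1 :: 'k)" for A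
    by (induction A rule: infinite_finite_induct) (simp_all add: var_power_def mult_single)
  from this[of "keys m"] show ?thesis
    by (simp add: sum_single_lookup)
qed

definition vars_below :: "nat \<Rightarrow> ((nat \<Rightarrow>\<^sub>0 nat) \<Rightarrow>\<^sub>0 'k::field) \<Rightarrow> bool"
  where "vars_below n p \<longleftrightarrow> (\<forall>m\<in>keys p. keys m \<subseteq> {..<n})"

lemma ex_vars_below: "\<exists>n. vars_below n p"
proof -
  have "finite (\<Union>m\<in>keys p. keys m)"
    by simp
  then obtain n where "\<forall>j\<in>(\<Union>m\<in>keys p. keys m). j < n"
    using finite_nat_set_iff_bounded by blast
  then show ?thesis
    unfolding vars_below_def by (intro exI[of _ n]) auto
qed

lemma poly_val_cong:
  assumes "vars_below n p" "\<And>j. j < n \<Longrightarrow> a j = b j"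
  shows "poly_val a p = poly_val b p"
proof -
  have "monom_val a m = monom_val b m" if "m \<in> keys p" for m
    unfolding monom_val_def using assms(1) that
    by (intro prod.cong) (auto simp: vars_below_def intro!: assms(2) arg_cong2[of _ _ _ _ "(^)"])
  then show ?thesis
    by (simp add: poly_val_def)
qed

section \<open>The polynomial ideal of the equations X_j^q = X_j\<close>

definition field_eq_poly :: "nat \<Rightarrow> nat \<Rightarrow> (nat \<Rightarrow>\<^sub>0 nat) \<Rightarrow>\<^sub>0 'k::field"
  where "field_eq_poly q j = var_power j q - var_power j 1"

lemma Iq_gen_eq: "Iq_gen q j = lookup (field_eq_poly q j)"
  by (rule ext)
    (auto simp: Iq_gen_def rs_var_pow_def field_eq_poly_def var_power_def lookup_minus lookup_single when_def)

text \<open>The algebraic part of \<open>gen_ideal\<close>: here the coefficients of the generators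
  are polynomials instead of restricted series, so ring identities apply directly.\<close>

definition poly_ideal :: "nat \<Rightarrow> ((nat \<Rightarrow>\<^sub>0 nat) \<Rightarrow>\<^sub>0 'k::field) set"
  where "poly_ideal q = {p. \<exists>J h. finite J \<and> p = (\<Sum>j\<in>J. h j * field_eq_poly q j)}"

lemma poly_ideal_0: "0 \<in> poly_ideal q"
  unfolding poly_ideal_def by (auto intro: exI[of _ "{}"])

lemma poly_ideal_gen: "field_eq_poly q j \<in> poly_ideal q"
  unfolding poly_ideal_def
  by (intro CollectI exI[of _ "{j}"] exI[of _ "\<lambda>_. 1"]) simp

lemma poly_ideal_mult: "p \<in> poly_ideal q \<Longrightarrow> r * p \<in> poly_ideal q"
proof -
  assume "p \<in> poly_ideal q"
  then obtain J h where "finite J" "p = (\<Sum>j\<in>J. h j * field_eq_poly q j)"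
    unfolding poly_ideal_def by blast
  then have "finite J \<and> r * p = (\<Sum>j\<in>J. (r * h j) * field_eq_poly q j)"
    by (simp add: sum_distrib_left mult.assoc)
  then show ?thesis
    unfolding poly_ideal_def by (intro CollectI exI[of _ J] exI[of _ "\<lambda>j. r * h j"])
qed

lemma poly_ideal_add:
  assumes "p \<in> poly_ideal q" "r \<in> poly_ideal q"
  shows "p + r \<in> poly_ideal q"
proof -
  obtain J h where p: "finite J" "p = (\<Sum>j\<in>J. h j * field_eq_poly q j)"
    using assms(1) unfolding poly_ideal_def by blast
  obtain K g where r: "finite K" "r = (\<Sum>j\<in>K. g j * field_eq_poly q j)"
    using assms(2) unfolding poly_ideal_def by blast
  define h' where "h' j = (if j \<in> J then h j else 0)" for j
  define g' where "g' j = (if j \<in> K then g j else 0)" for j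
  have "p = (\<Sum>j\<in>J \<union> K. h' j * field_eq_poly q j)"
    unfolding p(2) h'_def using p(1) r(1) by (intro sum.mono_neutral_cong_left) auto
  moreover have "r = (\<Sum>j\<in>J \<union> K. g' j * field_eq_poly q j)"
    unfolding r(2) g'_def using p(1) r(1) by (intro sum.mono_neutral_cong_left) auto
  ultimately have "p + r = (\<Sum>j\<in>J \<union> K. (h' j + g' j) * field_eq_poly q j)"
    by (simp add: sum.distrib distrib_right)
  then show ?thesis
    unfolding poly_ideal_def using p(1) r(1)
    by (intro CollectI exI[of _ "J \<union> K"] exI[of _ "\<lambda>j. h' j + g' j"]) simp
qed

lemma poly_ideal_sum: "(\<And>i. i \<in> A \<Longrightarrow> f i \<in> poly_ideal q) \<Longrightarrow> sum f A \<in> poly_ideal q"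
  by (induction A rule: infinite_finite_induct) (simp_all add: poly_ideal_0 poly_ideal_add)

text \<open>After multiplication by \<open>L\<close>, the polynomial \<open>p\<close> becomes
  congruent to its value at \<open>a\<close>. For fixed \<open>L\<close> and \<open>a\<close> such
  \<open>p\<close> form a subalgebra, so the property only has to be checked on the variables that
  occur.\<close>

definition reduces_at where
  "reduces_at q L a p \<longleftrightarrow> p * L - const_poly (poly_val a p) * L \<in> poly_ideal q"

lemma reduces_at_const: "reduces_at q L a (const_poly c)"
  by (simp add: reduces_at_def poly_ideal_0)

lemma reduces_at_add:
  assumes "reduces_at q L a p" "reduces_at q L a r"
  shows "reduces_at q L a (p + r)"
proof -
  have "(p + r) * L - const_poly (poly_val a (p + r)) * L =
      (p * L - const_poly (poly_val a p) * L) + (r * L - const_poly (poly_val a r) * L)"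
    by (simp add: poly_val_add const_poly_add algebra_simps)
  then show ?thesis
    using assms unfolding reduces_at_def by (simp only: poly_ideal_add)
qed

lemma reduces_at_mult:
  assumes "reduces_at q L a p" "reduces_at q L a r"
  shows "reduces_at q L a (p * r)"
proof -
  have "(p * r) * L - const_poly (poly_val a (p * r)) * L =
      p * (r * L - const_poly (poly_val a r) * L) +
      const_poly (poly_val a r) * (p * L - const_poly (poly_val a p) * L)"
    by (simp add: poly_val_mult const_poly_mult algebra_simps)
  then show ?thesis
    using assms unfolding reduces_at_def by (simp only: poly_ideal_add poly_ideal_mult)
qed

lemma reduces_at_sum: "(\<And>i. i \<in> A \<Longrightarrow> reduces_at q L a (f i)) \<Longrightarrow> reduces_at q L a (sum f A)"
  using reduces_at_const[of q L a 0]
  by (induction A rule: infinite_finite_induct) (simp_all add: reduces_at_add const_poly_def)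

lemma reduces_at_prod: "(\<And>i. i \<in> A \<Longrightarrow> reduces_at q L a (f i)) \<Longrightarrow> reduces_at q L a (prod f A)"
  using reduces_at_const[of q L a 1]
  by (induction A rule: infinite_finite_induct) (simp_all add: reduces_at_mult const_poly_1)

lemma reduces_at_power: "reduces_at q L a p \<Longrightarrow> reduces_at q L a (p ^ n)"
  using reduces_at_prod[of "{..<n}" q L a "\<lambda>_. p"] by simp

lemma reduces_at_vars_below:
  assumes "vars_below n p" and var: "\<And>j. j < n \<Longrightarrow> reduces_at q L a (var_power j 1)"
  shows "reduces_at q L a p"
proof -
  have "reduces_at q L a (single m (lookup p m))" if "m \<in> keys p" for m
  proof -
    have "reduces_at q L a (var_power j i)" if "j \<in> keys m" for j i
      using reduces_at_power[OF var[of j], of i] that \<open>m \<in> keys p\<close> assms(1)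
      by (auto simp: vars_below_def var_power_power)
    then have "reduces_at q L a (single m 1)"
      unfolding single_eq_prod_var_power by (rule reduces_at_prod)
    then have "reduces_at q L a (const_poly (lookup p m) * single m 1)"
      by (rule reduces_at_mult[OF reduces_at_const])
    then show ?thesis
      by (simp add: const_poly_def mult_single)
  qed
  then have "reduces_at q L a (\<Sum>m\<in>keys p. single m (lookup p m))"
    by (rule reduces_at_sum)
  then show ?thesis
    by (simp add: sum_single_lookup)
qed

section \<open>Lagrange polynomials on the roots of X^q - X\<close>

context nonarch_local_field
begin

lemma v_q_minus_1: "v (of_nat (q - 1)) = 1"
proof (rule v_eq_1_cong)
  show "v (of_nat (q - 1) - (- 1)) < 1"
    using v_of_nat_q_less q_ge_2 by (simp add: of_nat_diff)
qed simp

lemma q_minus_1_nonzero: "of_nat (q - 1) \<noteq> (0 :: 'k)"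
  using v_q_minus_1 by fastforce

lemma teich_power_q_minus_1:
  assumes "t \<in> teich" "t \<noteq> 0"
  shows "t ^ (q - 1) = 1"
proof -
  have "t * t ^ (q - 1) = t"
    using assms q_ge_2 by (simp add: teich_def flip: power_Suc)
  then show ?thesis
    using assms(2) by simp
qed

text \<open>X^i - 1 has at most i < q - 1 roots, so some nonzero root \<open>u\<close> of X^q - X
  has u^i different from 1. Replacing t by ut permutes the summands but multiplies the sum by the
  inverse of u^i.\<close>

lemma teich_power_sum:
  assumes "0 < i" "i < q - 1"
  shows "(\<Sum>t\<in>teich - {0}. inverse (t ^ i)) = 0"
proof -
  have "\<exists>u\<in>teich - {0}. u ^ i \<noteq> 1"
  proof (rule ccontr)
    assume *: "\<not> (\<exists>u\<in>teich - {0}. u ^ i \<noteq> 1)"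
    define P where "P = monom (1 :: 'k) i - 1"
    have deg: "degree P \<le> i"
      unfolding P_def by (intro degree_diff_le degree_monom_le) simp
    have "coeff P i = 1"
      using assms(1) by (simp add: P_def coeff_eq_0)
    then have nz: "P \<noteq> 0"
      by auto
    have "card (teich - {0}) \<le> card {x. poly P x = 0}"
      using * by (intro card_mono poly_roots_finite[OF nz]) (auto simp: P_def poly_monom)
    also have "\<dots> \<le> degree P"
      by (rule card_poly_roots_bound[OF nz])
    finally show False
      using deg assms(2) card_teich by simp
  qed
  then obtain u where u: "u \<in> teich" "u \<noteq> 0" "u ^ i \<noteq> 1"
    by blast
  have inj: "inj_on ((*) u) (teich - {0})"
    using u(2) by (intro inj_onI) simp
  have "(*) u ` (teich - {0}) = teich - {0}"
  proof (rule endo_inj_surj[OF _ _ inj])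
    show "(*) u ` (teich - {0}) \<subseteq> teich - {0}"
      using u by (auto simp: teich_def power_mult_distrib)
  qed simp
  then have "(\<Sum>t\<in>teich - {0}. inverse (t ^ i)) = (\<Sum>t\<in>teich - {0}. inverse ((u * t) ^ i))"
    using sum.reindex[OF inj, of "\<lambda>t. inverse (t ^ i)"] by simp
  also have "\<dots> = inverse (u ^ i) * (\<Sum>t\<in>teich - {0}. inverse (t ^ i))"
    by (simp add: power_mult_distrib sum_distrib_left)
  finally show ?thesis
    using u(3) by simp
qed

text \<open>The Lagrange interpolation polynomial of \<open>t\<close> on the roots of \<open>X\<^sup>q - X\<close>, namely
  \<open>1 - X\<^bsup>q-1\<^esup>\<close> for \<open>t = 0\<close> and \<open>(q - 1)\<^sup>-\<^sup>1 (X/t + \<dots> + (X/t)\<^bsup>q-1\<^esup>)\<close> otherwise.\<close>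

definition lagrange_coeff :: "'k \<Rightarrow> nat \<Rightarrow> 'k"
  where "lagrange_coeff t i =
    (if t = 0 then (if i = 0 then 1 else if i = q - 1 then - 1 else 0)
     else if i = 0 then 0 else inverse (t ^ i) / of_nat (q - 1))"

definition lagrange :: "nat \<Rightarrow> 'k \<Rightarrow> (nat \<Rightarrow>\<^sub>0 nat) \<Rightarrow>\<^sub>0 'k"
  where "lagrange j t = (\<Sum>i<q. single (single j i) (lagrange_coeff t i))"

text \<open>Only t = 0 contributes to the constant term. In degree q - 1 the -1 from t = 0 cancels
  the q - 1 equal terms 1/(q - 1), and in between the power sums vanish.\<close>

lemma lagrange_coeff_sum:
  assumes "i < q"
  shows "(\<Sum>t\<in>teich. lagrange_coeff t i) = (if i = 0 then 1 else 0)"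
proof -
  have split: "(\<Sum>t\<in>teich. lagrange_coeff t i) =
      lagrange_coeff 0 i + (\<Sum>t\<in>teich - {0}. lagrange_coeff t i)"
    by (rule sum.remove) simp_all
  consider "i = 0" | "i = q - 1" "i \<noteq> 0" | "0 < i" "i < q - 1"
    using assms by linarith
  then show ?thesis
  proof cases
    case 1
    then show ?thesis
      unfolding split by (simp add: lagrange_coeff_def)
  next
    case 2
    have "(\<Sum>t\<in>teich - {0}. lagrange_coeff t i) = (\<Sum>t\<in>teich - {0}. 1 / of_nat (q - 1))"
      using 2 by (intro sum.cong) (auto simp: lagrange_coeff_def teich_power_q_minus_1[simplified])
    also have "\<dots> = 1"
      using q_minus_1_nonzero card_teich by simp
    finally show ?thesis
      unfolding split using 2 by (simp add: lagrange_coeff_def)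
  next
    case 3
    have "(\<Sum>t\<in>teich - {0}. lagrange_coeff t i) =
        (\<Sum>t\<in>teich - {0}. inverse (t ^ i)) / of_nat (q - 1)"
      unfolding sum_divide_distrib using 3 by (intro sum.cong) (auto simp: lagrange_coeff_def)
    then show ?thesis
      unfolding split using 3 by (simp add: teich_power_sum) (simp add: lagrange_coeff_def)
  qed
qed

lemma lagrange_sum: "(\<Sum>t\<in>teich. lagrange j t) = 1"
proof -
  have single_sum: "single m (sum f A) = (\<Sum>t\<in>A. single m (f t))" for m :: "nat \<Rightarrow>\<^sub>0 nat" and f :: "'k \<Rightarrow> 'k" and A
    by (induction A rule: infinite_finite_induct) (simp_all add: single_add)
  have "(\<Sum>t\<in>teich. lagrange j t) = (\<Sum>i<q. \<Sum>t\<in>teich. single (single j i) (lagrange_coeff t i))"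
    unfolding lagrange_def by (rule sum.swap)
  also have "\<dots> = (\<Sum>i<q. single (single j i) (if i = 0 then 1 else 0))"
    by (intro sum.cong refl) (simp add: lagrange_coeff_sum flip: single_sum)
  also have "\<dots> = (\<Sum>i\<in>{0}. single (single j i) (if i = 0 then 1 else 0))"
    using q_ge_2 by (intro sum.mono_neutral_right) auto
  finally show ?thesis
    by simp
qed

text \<open>X^q - X is divisible by X - t, and the Lagrange polynomial is the quotient up to a
  constant: -1 for t = 0 and 1/(q - 1) otherwise. This is where the generators of the ideal
  enter.\<close>

lemma lagrange_root:
  assumes "t \<in> teich"
  shows "\<exists>c. var_power j 1 * lagrange j t - const_poly t * lagrange j t = const_poly c * field_eq_poly q j"
proof -
  have lhs: "var_power j 1 * lagrange j t - const_poly t * lagrange j t =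
      (\<Sum>i<q. single (single j (Suc i)) (lagrange_coeff t i)) -
      (\<Sum>i<q. single (single j i) (t * lagrange_coeff t i))"
    unfolding lagrange_def sum_distrib_left
    by (simp add: var_power_def const_poly_def mult_single flip: single_add)
  show ?thesis
  proof (cases "t = 0")
    case True
    have "(\<Sum>i<q. single (single j (Suc i)) (lagrange_coeff t i)) =
        (\<Sum>i\<in>{0, q - 1}. single (single j (Suc i)) (lagrange_coeff t i))"
      using q_ge_2 True by (intro sum.mono_neutral_right) (auto simp: lagrange_coeff_def)
    also have "\<dots> = var_power j 1 - var_power j q"
      using q_ge_2 True by (simp add: lagrange_coeff_def var_power_def single_uminus)
    finally have "var_power j 1 * lagrange j t - const_poly t * lagrange j t =
        const_poly (- 1) * field_eq_poly q j"
      unfolding lhs by (simp add: True field_eq_poly_def const_poly_def single_uminus)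
    then show ?thesis ..
  next
    case False
    define d where "d = inverse (of_nat (q - 1) :: 'k)"
    \<comment> \<open>\<open>h i\<close> is t d (X/t)^i. Multiplying the term of index i of the
      Lagrange polynomial by X gives \<open>h (Suc i)\<close> and by t gives \<open>h i\<close>, so
      the difference telescopes; the two ends have coefficient d because t^(q-1) = 1.\<close>
    define h where "h i = single (single j i) (inverse (t ^ (i - 1)) * d)" for i
    have "(\<Sum>i<q. single (single j (Suc i)) (lagrange_coeff t i)) = (\<Sum>i=1..<q. h (Suc i))"
      using False by (intro sum.mono_neutral_cong_right)
        (auto simp: lagrange_coeff_def h_def d_def divide_inverse)
    moreover have "single (single j i) (t * lagrange_coeff t i) = h i" if "1 \<le> i" for i
    proof -
      have "t * inverse (t ^ i) = inverse (t ^ (i - 1))"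
        using False that by (cases i) auto
      then show ?thesis
        using False that by (simp add: lagrange_coeff_def h_def d_def divide_inverse mult.assoc[symmetric])
    qed
    then have "(\<Sum>i<q. single (single j i) (t * lagrange_coeff t i)) = (\<Sum>i=1..<q. h i)"
      using False by (intro sum.mono_neutral_cong_right) (auto simp: lagrange_coeff_def Suc_le_eq)
    ultimately have "var_power j 1 * lagrange j t - const_poly t * lagrange j t =
        (\<Sum>i=1..<q. h (Suc i) - h i)"
      unfolding lhs by (simp add: sum_subtractf)
    also have "\<dots> = h q - h 1"
      using q_ge_2 by (intro sum_Suc_diff') simp
    also have "\<dots> = const_poly d * field_eq_poly q j"
      using False assms by (simp add: h_def teich_power_q_minus_1[simplified] field_eq_poly_def
          var_power_def const_poly_def mult_single right_diff_distrib)
    finally show ?thesis ..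
  qed
qed

text \<open>A nonzero root is a root of unity and so has value 1, and q - 1 is a unit. No
  denominator can enlarge a coefficient.\<close>

lemma bounded_by_lagrange:
  assumes "t \<in> teich"
  shows "bounded_by (lookup (lagrange j t)) 1"
  unfolding lagrange_def
proof (rule bounded_by_lookup_sum)
  fix i
  have "t \<noteq> 0 \<Longrightarrow> v t = 1"
  proof -
    assume "t \<noteq> 0"
    then have "v t ^ (q - 1) = 1 ^ (q - 1)"
      using teich_power_q_minus_1[OF assms] by (simp flip: v_power)
    then show "v t = 1"
      using q_ge_2 by (intro power_eq_imp_eq_base[of "v t" "q - 1" 1]) auto
  qed
  then have "v (lagrange_coeff t i) \<le> 1"
    using v_q_minus_1 by (simp add: lagrange_coeff_def v_divide v_inverse v_power)
  then show "bounded_by (lookup (single (single j i) (lagrange_coeff t i))) 1"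
    by (simp add: bounded_by_def lookup_single when_def)
qed simp

text \<open>At a root the relation of \<open>lagrange_root\<close> reads (a_j - s) L_s(a_j) = 0, so
  only s = a_j survives; the partition of unity \<open>lagrange_sum\<close> then forces the
  surviving value to be 1.\<close>

lemma poly_val_lagrange:
  assumes a: "\<And>j. a j \<in> teich" and t: "t \<in> teich"
  shows "poly_val a (lagrange j t) = (if a j = t then 1 else 0)"
proof -
  have zero: "poly_val a (lagrange j s) = 0" if s: "s \<in> teich" "a j \<noteq> s" for s
  proof -
    obtain c where "var_power j 1 * lagrange j s - const_poly s * lagrange j s =
        const_poly c * field_eq_poly q j"
      using lagrange_root[OF s(1)] ..
    from arg_cong[OF this, of "poly_val a"]
    have "(a j - s) * poly_val a (lagrange j s) = c * (a j ^ q - a j)"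
      by (simp add: poly_val_mult poly_val_diff field_eq_poly_def left_diff_distrib)
    moreover have "a j ^ q = a j"
      using a[of j] by (simp add: teich_def)
    ultimately show ?thesis
      using s(2) by simp
  qed
  have "1 = (\<Sum>t\<in>teich. poly_val a (lagrange j t))"
    using arg_cong[OF lagrange_sum[of j], of "poly_val a"] by (simp add: poly_val_sum)
  also have "\<dots> = (\<Sum>t\<in>{a j}. poly_val a (lagrange j t))"
    using a[of j] by (intro sum.mono_neutral_right) (auto intro: zero)
  finally have "poly_val a (lagrange j (a j)) = 1"
    by simp
  then show ?thesis
    using zero[OF t] by auto
qed

section \<open>Interpolation on finite grids\<close>

abbreviation cube :: "nat \<Rightarrow> (nat \<Rightarrow> 'k) set"
  where "cube n \<equiv> {..<n} \<rightarrow>\<^sub>E teich"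

definition lagrange_prod :: "nat \<Rightarrow> (nat \<Rightarrow> 'k) \<Rightarrow> (nat \<Rightarrow>\<^sub>0 nat) \<Rightarrow>\<^sub>0 'k"
  where "lagrange_prod n b = (\<Prod>j<n. lagrange j (b j))"

lemma lagrange_prod_sum: "(\<Sum>b\<in>cube n. lagrange_prod n b) = 1"
proof -
  have "(\<Prod>j<n. \<Sum>t\<in>teich. lagrange j t) = (\<Sum>b\<in>cube n. \<Prod>j<n. lagrange j (b j))"
    by (rule prod_sum_PiE) simp_all
  then show ?thesis
    by (simp add: lagrange_sum lagrange_prod_def)
qed

lemma poly_val_lagrange_prod:
  assumes a: "\<And>j. a j \<in> teich" and b: "b \<in> cube n"
  shows "poly_val a (lagrange_prod n b) = (if restrict a {..<n} = b then 1 else 0)"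
proof -
  have "poly_val a (lagrange_prod n b) = (\<Prod>j<n. if a j = b j then 1 else 0)"
    unfolding lagrange_prod_def poly_val_prod
  proof (rule prod.cong[OF refl])
    fix j assume "j \<in> {..<n}"
    then have "b j \<in> teich"
      by (rule PiE_mem[OF b])
    then show "poly_val a (lagrange j (b j)) = (if a j = b j then 1 else 0)"
      by (rule poly_val_lagrange[OF a])
  qed
  also have "\<dots> = (if \<forall>j<n. a j = b j then 1 else 0)"
    by auto
  \<comment> \<open>Grid points are extensional functions, so agreement on \<open>{..<n}\<close> is
    equality with the restriction.\<close>
  also have "(\<forall>j<n. a j = b j) \<longleftrightarrow> restrict a {..<n} = b"
    using b by (auto simp: fun_eq_iff PiE_def extensional_def restrict_def)
  finally show ?thesis .
qed

text \<open>The product contains the factor for the coordinate j, and X_j - b_j times that factor is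
  a multiple of the generator. All variables can thus be replaced by the coordinates of
  \<open>b\<close>.\<close>

lemma reduces_at_lagrange_prod:
  assumes "vars_below n p" and b: "b \<in> cube n"
  shows "reduces_at q (lagrange_prod n b) b p"
proof (rule reduces_at_vars_below[OF assms(1)])
  fix j assume j: "j < n"
  then have "b j \<in> teich"
    using PiE_mem[OF b, of j] by simp
  then obtain c where c: "var_power j 1 * lagrange j (b j) - const_poly (b j) * lagrange j (b j) =
      const_poly c * field_eq_poly q j"
    using lagrange_root by blast
  have L: "lagrange_prod n b = lagrange j (b j) * (\<Prod>i\<in>{..<n} - {j}. lagrange i (b i))"
    unfolding lagrange_prod_def using j by (intro prod.remove) auto
  have "var_power j 1 * lagrange_prod n b - const_poly (b j) * lagrange_prod n b =
      (var_power j 1 * lagrange j (b j) - const_poly (b j) * lagrange j (b j)) *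
      (\<Prod>i\<in>{..<n} - {j}. lagrange i (b i))"
    unfolding L by (simp add: algebra_simps)
  also have "\<dots> = (const_poly c * (\<Prod>i\<in>{..<n} - {j}. lagrange i (b i))) * field_eq_poly q j"
    unfolding c by (simp add: mult_ac)
  finally show "reduces_at q (lagrange_prod n b) b (var_power j 1)"
    unfolding reduces_at_def by (simp add: poly_ideal_mult poly_ideal_gen)
qed

definition interpolate :: "nat \<Rightarrow> ((nat \<Rightarrow> 'k) \<Rightarrow> 'k) \<Rightarrow> (nat \<Rightarrow>\<^sub>0 nat) \<Rightarrow>\<^sub>0 'k"
  where "interpolate n g = (\<Sum>b\<in>cube n. const_poly (g b) * lagrange_prod n b)"

lemma interpolate_diff: "interpolate n g - interpolate n h = interpolate n (\<lambda>b. g b - h b)"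
  by (simp add: interpolate_def const_poly_diff left_diff_distrib sum_subtractf)

lemma poly_val_interpolate:
  assumes a: "\<And>j. a j \<in> teich"
  shows "poly_val a (interpolate n g) = g (restrict a {..<n})"
proof -
  have "poly_val a (interpolate n g) = (\<Sum>b\<in>cube n. g b * poly_val a (lagrange_prod n b))"
    by (simp add: interpolate_def poly_val_sum poly_val_mult)
  also have "\<dots> = (\<Sum>b\<in>cube n. if restrict a {..<n} = b then g b else 0)"
    by (rule sum.cong) (simp_all add: poly_val_lagrange_prod[OF a])
  also have "\<dots> = (if restrict a {..<n} \<in> cube n then g (restrict a {..<n}) else 0)"
    by (rule sum.delta') (simp add: finite_PiE)
  also have "\<dots> = g (restrict a {..<n})"
    using a by (simp add: PiE_def)
  finally show ?thesis .
qed

lemma bounded_by_interpolate: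
  assumes "\<And>b. b \<in> cube n \<Longrightarrow> v (g b) \<le> c" "0 \<le> c"
  shows "bounded_by (lookup (interpolate n g)) c"
  unfolding interpolate_def
proof (rule bounded_by_lookup_sum[OF _ assms(2)])
  fix b assume b: "b \<in> cube n"
  have "bounded_by (lookup (lagrange_prod n b)) 1"
    unfolding lagrange_prod_def
  proof (rule bounded_by_prod)
    fix j assume "j \<in> {..<n}"
    then show "bounded_by (lookup (lagrange j (b j))) 1"
      by (intro bounded_by_lagrange PiE_mem[OF b])
  qed
  moreover have "bounded_by (lookup (const_poly (g b))) c"
    using assms(1)[OF b] assms(2) by (simp add: bounded_by_def const_poly_def lookup_single when_def)
  ultimately show "bounded_by (lookup (const_poly (g b) * lagrange_prod n b)) c"
    using bounded_by_mult[of "const_poly (g b)" c "lagrange_prod n b" 1] by simp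
qed

text \<open>Summing over the new coordinate produces the factor \<open>lagrange_sum\<close>, which
  is 1. This makes interpolants on consecutive grids comparable.\<close>

lemma interpolate_Suc:
  "interpolate (Suc n) (\<lambda>b. g (restrict b {..<n})) = interpolate n g"
proof -
  have cube: "cube (Suc n) = (\<lambda>(t, b). b(n := t)) ` (teich \<times> cube n)"
    unfolding lessThan_Suc by (rule PiE_insert_eq)
  have inj: "inj_on (\<lambda>(t, b). b(n := t)) (teich \<times> cube n)"
    by (rule inj_combinator) simp
  have restr: "restrict (b(n := t)) {..<n} = b" if "b \<in> cube n" for b t
    using that by (auto simp: fun_eq_iff PiE_def extensional_def)
  have prod: "lagrange_prod (Suc n) (b(n := t)) = lagrange_prod n b * lagrange n t" for b t
    by (simp add: lagrange_prod_def)
  have "interpolate (Suc n) (\<lambda>b. g (restrict b {..<n})) =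
      (\<Sum>(t, b)\<in>teich \<times> cube n. const_poly (g (restrict (b(n := t)) {..<n})) * lagrange_prod (Suc n) (b(n := t)))"
    unfolding interpolate_def cube sum.reindex[OF inj] by (simp add: case_prod_beta)
  also have "\<dots> = (\<Sum>(t, b)\<in>teich \<times> cube n. const_poly (g b) * lagrange_prod n b * lagrange n t)"
  proof (rule sum.cong[OF refl], clarify)
    fix t b assume "b \<in> cube n"
    then show "const_poly (g (restrict (b(n := t)) {..<n})) * lagrange_prod (Suc n) (b(n := t)) =
        const_poly (g b) * lagrange_prod n b * lagrange n t"
      unfolding prod restr[OF \<open>b \<in> cube n\<close>] by (simp only: mult.assoc)
  qed
  also have "\<dots> = (\<Sum>t\<in>teich. interpolate n g * lagrange n t)"
    by (simp add: interpolate_def sum_distrib_right flip: sum.cartesian_product)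
  also have "\<dots> = interpolate n g"
    by (simp add: lagrange_sum flip: sum_distrib_left)
  finally show ?thesis .
qed

text \<open>Multiply \<open>p\<close> by 1, written as the sum of the Lagrange products, and replace
  \<open>p\<close> by its value at the grid point in each summand.\<close>

lemma poly_diff_interpolate_in_ideal:
  assumes "vars_below n p"
  shows "p - interpolate n (\<lambda>b. poly_val b p) \<in> poly_ideal q"
proof -
  have "p - interpolate n (\<lambda>b. poly_val b p) =
      p * (\<Sum>b\<in>cube n. lagrange_prod n b) - interpolate n (\<lambda>b. poly_val b p)"
    by (simp add: lagrange_prod_sum)
  also have "\<dots> = (\<Sum>b\<in>cube n. p * lagrange_prod n b - const_poly (poly_val b p) * lagrange_prod n b)"
    by (simp add: interpolate_def sum_distrib_left sum_subtractf)
  also have "\<dots> \<in> poly_ideal q"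
    using reduces_at_lagrange_prod[OF assms] unfolding reduces_at_def by (intro poly_ideal_sum)
  finally show ?thesis .
qed

section \<open>Digit expansions in O\<close>

definition residue_digit :: "'k \<Rightarrow> 'k"
  where "residue_digit x = (SOME t. t \<in> teich \<and> v (x - t) < 1)"

definition shift :: "'k \<Rightarrow> 'k"
  where "shift x = (x - residue_digit x) / unif"

definition digit :: "'k \<Rightarrow> nat \<Rightarrow> 'k"
  where "digit x j = residue_digit ((shift ^^ j) x)"

definition digit_sum :: "nat \<Rightarrow> (nat \<Rightarrow> 'k) \<Rightarrow> 'k"
  where "digit_sum n a = (\<Sum>j<n. a j * unif ^ j)"

lemma residue_digit:
  assumes "v x \<le> 1"
  shows "residue_digit x \<in> teich" "v (x - residue_digit x) < 1"
proof -
  have "\<exists>t. t \<in> teich \<and> v (x - t) < 1"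
    using ex_teich[OF assms] by blast
  from someI_ex[OF this] show "residue_digit x \<in> teich" "v (x - residue_digit x) < 1"
    by (simp_all add: residue_digit_def)
qed

lemma residue_digit_eqI:
  assumes "v x \<le> 1" "t \<in> teich" "v (x - t) < 1"
  shows "residue_digit x = t"
proof (rule teich_cong_eq[OF residue_digit(1)[OF assms(1)] assms(2)])
  show "v (residue_digit x - t) < 1"
    using v_triangle_less[of "residue_digit x" x 1 t] residue_digit(2)[OF assms(1)] assms(3)
    by (simp add: v_minus_commute)
qed

lemma v_shift_le:
  assumes "v x \<le> 1"
  shows "v (shift x) \<le> 1"
  using v_le_v_unif[OF residue_digit(2)[OF assms]] by (simp add: shift_def v_divide)

lemma v_funpow_shift_le: "v x \<le> 1 \<Longrightarrow> v ((shift ^^ n) x) \<le> 1"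
  by (induction n) (simp_all add: v_shift_le)

lemma digit_in_teich: "v x \<le> 1 \<Longrightarrow> digit x j \<in> teich"
  unfolding digit_def by (intro residue_digit v_funpow_shift_le)

lemma unit_seq_digit: "v x \<le> 1 \<Longrightarrow> unit_seq (digit x)"
  by (simp add: unit_seq_def digit_in_teich v_teich_le)

lemma digit_0: "digit x 0 = residue_digit x"
  by (simp add: digit_def)

lemma digit_Suc: "digit x (Suc j) = digit (shift x) j"
  by (simp add: digit_def funpow_Suc_right del: funpow.simps)

lemma digit_expansion: "x = digit_sum n (digit x) + unif ^ n * (shift ^^ n) x"
proof (induction n)
  case 0
  then show ?case
    by (simp add: digit_sum_def)
next
  case (Suc n)
  have "(shift ^^ n) x = digit x n + unif * (shift ^^ Suc n) x"
    by (simp add: digit_def shift_def)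
  then have "unif ^ n * (shift ^^ n) x = digit x n * unif ^ n + unif ^ Suc n * (shift ^^ Suc n) x"
    by (simp only: distrib_left power_Suc2 mult_ac)
  then show ?case
    using Suc by (simp add: digit_sum_def add.assoc)
qed

lemma v_diff_digit_sum_le:
  assumes "v x \<le> 1"
  shows "v (digit_sum n (digit x) - x) \<le> v unif ^ n"
proof -
  have "digit_sum n (digit x) - x = - (unif ^ n * (shift ^^ n) x)"
    by (subst (2) digit_expansion[of x n]) simp
  then show ?thesis
    using v_funpow_shift_le[OF assms, of n] mult_left_mono[of "v ((shift ^^ n) x)" 1 "v unif ^ n"]
    by (simp add: v_mult v_power)
qed

text \<open>Congruent elements share the leading digit, so subtracting it keeps the difference and
  dividing by \<open>unif\<close> lowers the precision by one.\<close>

lemma digit_cong: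
  assumes "v x \<le> 1" "v y \<le> 1" "v (x - y) \<le> v unif ^ n" "j < n"
  shows "digit x j = digit y j"
  using assms
proof (induction n arbitrary: x y j)
  case (Suc n)
  have "v unif ^ Suc n < 1"
    using v_unif_less_1 by (intro power_Suc_less_one) auto
  then have "v (x - y) < 1"
    using Suc.prems(3) by linarith
  then have "v (x - residue_digit y) < 1"
    using v_triangle_less[of x y 1 "residue_digit y"] residue_digit(2)[OF Suc.prems(2)] by simp
  then have eq: "residue_digit x = residue_digit y"
    by (intro residue_digit_eqI Suc.prems(1) residue_digit(1) Suc.prems(2))
  then have "shift x - shift y = (x - y) / unif"
    by (simp add: shift_def diff_divide_distrib)
  then have "v (shift x - shift y) \<le> v unif ^ n"
    using Suc.prems(3) by (simp add: v_divide divide_le_eq mult.commute)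
  then have "digit (shift x) i = digit (shift y) i" if "i < n" for i
    using Suc.IH Suc.prems(1,2) that by (simp add: v_shift_le)
  then show ?case
    using eq Suc.prems(4) by (cases j) (simp_all add: digit_0 digit_Suc)
qed simp

lemma v_digit_sum_le:
  assumes "\<And>j. j < n \<Longrightarrow> a j \<in> teich"
  shows "v (digit_sum n a) \<le> 1"
  unfolding digit_sum_def
proof (rule v_sum_le)
  fix j assume "j \<in> {..<n}"
  then have "v (a j) \<le> 1"
    using assms v_teich_le by simp
  then show "v (a j * unif ^ j) \<le> 1"
    using v_unif_less_1 by (intro v_mult_le_1 v_power_le_1) simp_all
qed simp

text \<open>Every finite string of roots is the beginning of the expansion of an actual element of
  O. Hence vanishing on O controls values on the entire grid.\<close>

lemma digit_digit_sum:
  assumes "\<And>j. j < n \<Longrightarrow> a j \<in> teich" "j < n"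
  shows "digit (digit_sum n a) j = a j"
  using assms
proof (induction n arbitrary: a j)
  case (Suc n)
  define y where "y = digit_sum n (\<lambda>i. a (Suc i))"
  have y: "v y \<le> 1"
    unfolding y_def using Suc.prems(1) by (intro v_digit_sum_le) simp
  have x: "digit_sum (Suc n) a = a 0 + unif * y"
    unfolding digit_sum_def sum.lessThan_Suc_shift y_def
    by (simp add: sum_distrib_left mult_ac)
  have "v (y * unif) < 1"
    by (rule v_mult_less_1[OF y v_unif_less_1])
  then have d: "residue_digit (digit_sum (Suc n) a) = a 0"
    using Suc.prems(1)
    by (intro residue_digit_eqI v_digit_sum_le) (simp_all add: x mult.commute)
  then have "shift (digit_sum (Suc n) a) = y"
    by (simp add: shift_def x)
  then show ?case
    using d Suc.IH[of "\<lambda>i. a (Suc i)"] Suc.prems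
    by (cases j) (simp_all add: digit_0 digit_Suc y_def)
qed simp

end

section \<open>The isomorphism\<close>

lemma sum_fun_apply: "sum F A x = (\<Sum>i\<in>A. F i x)" for F :: "'i \<Rightarrow> 'b \<Rightarrow> 'c::comm_monoid_add"
  by (induction A rule: infinite_finite_induct) simp_all

lemma (in nonarch_field) lookup_poly_ideal_in_gen_ideal:
  assumes "p \<in> poly_ideal q"
  shows "lookup p \<in> gen_ideal v q"
proof -
  obtain J h where J: "finite J" and p: "p = (\<Sum>j\<in>J. h j * field_eq_poly q j)"
    using assms unfolding poly_ideal_def by blast
  have "lookup p = (\<Sum>j\<in>J. rs_mult (lookup (h j)) (Iq_gen q j))"
    by (rule ext) (simp add: p lookup_sum sum_fun_apply Iq_gen_eq rs_mult_lookup)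
  then show ?thesis
    unfolding gen_ideal_def using J by (intro CollectI exI[of _ J] exI[of _ "\<lambda>j. lookup (h j)"]) simp
qed

section \<open>The kernel of evaluation\<close>

context nonarch_local_field
begin

lemma gen_ideal_vanishes:
  assumes "h \<in> gen_ideal v q"
  shows "h \<in> restricted v"
    and "unit_seq a \<Longrightarrow> (\<And>j. a j \<in> teich) \<Longrightarrow> eval a h = 0"
proof -
  obtain J g where J: "finite J" "\<forall>j\<in>J. g j \<in> restricted v"
    and h: "h = (\<Sum>j\<in>J. rs_mult (g j) (Iq_gen q j))"
    using assms unfolding gen_ideal_def by blast
  have zero: "(0 :: 'k rseries) = lookup 0"
    by (rule ext) simp
  have "(\<Sum>j\<in>J. rs_mult (g j) (Iq_gen q j)) \<in> restricted v \<and>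
      (unit_seq a \<longrightarrow> (\<forall>j. a j \<in> teich) \<longrightarrow> eval a (\<Sum>j\<in>J. rs_mult (g j) (Iq_gen q j)) = 0)"
    for a
    using J
  proof (induction J rule: finite_induct)
    case empty
    show ?case
      unfolding sum.empty zero by (intro conjI impI lookup_restricted) (simp only: eval_lookup poly_val_0)
  next
    case (insert j J)
    have gj: "g j \<in> restricted v"
      using insert.prems by simp
    have r: "rs_mult (g j) (Iq_gen q j) \<in> restricted v"
      unfolding Iq_gen_eq by (rule restricted_mult[OF gj lookup_restricted])
    have rs: "(\<Sum>j\<in>J. rs_mult (g j) (Iq_gen q j)) \<in> restricted v"
      using insert by simp
    have zero_term: "eval a (rs_mult (g j) (Iq_gen q j)) = 0" if "unit_seq a" "\<forall>j. a j \<in> teich"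
    proof -
      have "poly_val a (field_eq_poly q j) = 0"
        using that(2) by (simp add: field_eq_poly_def poly_val_diff teich_def)
      then show ?thesis
        unfolding Iq_gen_eq eval_mult[OF that(1) gj lookup_restricted] eval_lookup[OF that(1)] by simp
    qed
    show ?case
      unfolding sum.insert[OF insert.hyps]
    proof (intro conjI impI)
      assume a: "unit_seq a" "\<forall>j. a j \<in> teich"
      then have "eval a (\<Sum>j\<in>J. rs_mult (g j) (Iq_gen q j)) = 0"
        using insert by simp
      then show "eval a (rs_mult (g j) (Iq_gen q j) + (\<Sum>j\<in>J. rs_mult (g j) (Iq_gen q j))) = 0"
        unfolding eval_add[OF a(1) r rs] zero_term[OF a] by simp
    qed (rule restricted_add[OF r rs])
  qed
  then show "h \<in> restricted v" "unit_seq a \<Longrightarrow> (\<And>j. a j \<in> teich) \<Longrightarrow> eval a h = 0"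
    unfolding h by blast+
qed

lemma Iq_vanishes:
  assumes f: "f \<in> Iq v q" and a: "unit_seq a" "\<And>j. a j \<in> teich"
  shows "eval a f = 0"
proof (rule eq_if_v_diff_small)
  fix e :: real assume "0 < e"
  then obtain h where h: "h \<in> gen_ideal v q" "rs_norm v (f - h) < e"
    using f unfolding Iq_def by blast
  have f': "f \<in> restricted v"
    using f unfolding Iq_def by blast
  note h' = gen_ideal_vanishes(1)[OF h(1)]
  have "bounded_by (f - h) e"
    using h(2) by (intro bounded_by_mono[OF bounded_by_rs_norm[OF restricted_diff[OF f' h']]]) simp
  then have "v (eval a (f - h)) \<le> e"
    by (rule v_eval_le[OF a(1) restricted_diff[OF f' h']])
  then show "v (eval a f - 0) \<le> e"
    using gen_ideal_vanishes(2)[OF h(1) a] by (simp add: eval_diff[OF a(1) f' h'])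
qed

text \<open>For the converse, take a polynomial \<open>p\<close> near \<open>f\<close>. Its values
  on the grid are small since \<open>f\<close> vanishes on O, so its interpolant \<open>r\<close>
  has small coefficients; p - r lies in the ideal and is still near \<open>f\<close>.\<close>

lemma Iq_iff: "f \<in> Iq v q \<longleftrightarrow> f \<in> restricted v \<and> (\<forall>x. v x \<le> 1 \<longrightarrow> eval (digit x) f = 0)"
proof (intro iffI conjI allI impI)
  assume "f \<in> Iq v q"
  then show "f \<in> restricted v"
    by (simp add: Iq_def)
  show "eval (digit x) f = 0" if "v x \<le> 1" for x
    using \<open>f \<in> Iq v q\<close> unit_seq_digit[OF that] digit_in_teich[OF that] by (rule Iq_vanishes)
next
  assume "f \<in> restricted v \<and> (\<forall>x. v x \<le> 1 \<longrightarrow> eval (digit x) f = 0)"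
  then have f: "f \<in> restricted v" and zero: "\<And>x. v x \<le> 1 \<Longrightarrow> eval (digit x) f = 0"
    by simp_all
  have "\<exists>h\<in>gen_ideal v q. rs_norm v (f - h) < e" if e: "0 < e" for e
  proof -
    obtain p where p: "bounded_by (f - lookup p) (e / 2)"
      using restricted_approx[OF f, of "e / 2"] e by auto
    obtain n where n: "vars_below n p"
      using ex_vars_below ..
    define r where "r = interpolate n (\<lambda>b. poly_val b p)"
    have "bounded_by (lookup r) (e / 2)"
      unfolding r_def
    proof (rule bounded_by_interpolate)
      fix b assume b: "b \<in> cube n"
      have bt: "b j \<in> teich" if "j < n" for j
        using PiE_mem[OF b, of j] that by simp
      \<comment> \<open>An element of O whose first n digits are \<open>b\<close>, so that
        \<open>p\<close> cannot distinguish \<open>b\<close> from the full digit sequence of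
        \<open>x\<close>.\<close>
      define x where "x = digit_sum n b"
      have x: "v x \<le> 1"
        unfolding x_def using bt by (rule v_digit_sum_le)
      have "poly_val (digit x) p = poly_val b p"
        using n by (rule poly_val_cong) (simp add: x_def digit_digit_sum bt)
      then show "v (poly_val b p) \<le> e / 2"
        using eval_approx[OF unit_seq_digit[OF x] f p] zero[OF x] by simp
    qed (use e in simp)
    then have "bounded_by ((f - lookup p) + lookup r) (e / 2)"
      by (rule bounded_by_add[OF p])
    moreover have "f - lookup (p - r) = (f - lookup p) + lookup r"
      by (rule ext) (simp add: lookup_minus)
    ultimately have "bounded_by (f - lookup (p - r)) (e / 2)"
      by (simp only:)
    then have "rs_norm v (f - lookup (p - r)) < e"
      using rs_norm_le[of "f - lookup (p - r)" "e / 2"] e by simp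
    moreover have "lookup (p - r) \<in> gen_ideal v q"
      unfolding r_def by (intro lookup_poly_ideal_in_gen_ideal poly_diff_interpolate_in_ideal n)
    ultimately show ?thesis by blast
  qed
  then show "f \<in> Iq v q"
    using f by (simp add: Iq_def)
qed

section \<open>Series as continuous functions, and uniform continuity\<close>

definition digit_eval :: "'k rseries \<Rightarrow> 'k \<Rightarrow> 'k"
  where "digit_eval f x = (if x \<in> val_ring v then eval (digit x) f else 0)"

text \<open>A polynomial near \<open>f\<close> involves only finitely many digits, and these are
  constant on balls of radius \<open>v unif ^ n\<close>. So \<open>f\<close> is a uniform limit of
  locally constant functions.\<close>

lemma digit_eval_in_cont_funs:
  assumes f: "f \<in> restricted v"
  shows "digit_eval f \<in> cont_funs v"
proof -
  have "\<exists>d>0. \<forall>y\<in>val_ring v. v (y - x) < d \<longrightarrow> v (digit_eval f y - digit_eval f x) < e"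
    if x: "x \<in> val_ring v" and e: "0 < e" for x e
  proof -
    obtain p where p: "bounded_by (f - lookup p) (e / 2)"
      using restricted_approx[OF f, of "e / 2"] e by auto
    obtain n where n: "vars_below n p"
      using ex_vars_below ..
    have "v (digit_eval f y - digit_eval f x) < e" if y: "y \<in> val_ring v" "v (y - x) < v unif ^ n" for y
    proof -
      have xy: "v x \<le> 1" "v y \<le> 1"
        using x y(1) by (simp_all add: val_ring_def)
      have "poly_val (digit y) p = poly_val (digit x) p"
        using n by (rule poly_val_cong) (rule digit_cong[OF xy(2,1) less_imp_le[OF y(2)]])
      then have "v (eval (digit y) f - poly_val (digit x) p) \<le> e / 2"
        using eval_approx[OF unit_seq_digit[OF xy(2)] f p] by simp
      moreover have "v (poly_val (digit x) p - eval (digit x) f) \<le> e / 2"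
        using eval_approx[OF unit_seq_digit[OF xy(1)] f p] by (simp add: v_minus_commute)
      ultimately have "v (eval (digit y) f - eval (digit x) f) \<le> e / 2"
        by (rule v_triangle)
      then show ?thesis
        using x y(1) e by (simp add: digit_eval_def)
    qed
    then show ?thesis
      by (intro exI[of _ "v unif ^ n"]) simp
  qed
  then show ?thesis
    by (simp add: cont_funs_def digit_eval_def)
qed

lemma v_digit_eval_le:
  assumes "f \<in> restricted v" "bounded_by f c"
  shows "v (digit_eval f x) \<le> c"
proof (cases "x \<in> val_ring v")
  case True
  then show ?thesis
    using v_eval_le[OF unit_seq_digit assms] by (simp add: digit_eval_def val_ring_def)
qed (use bounded_by_nonneg[OF assms(2)] in \<open>simp add: digit_eval_def\<close>)

text \<open>Compactness of O by subdivision: each ball splits into q smaller ones, indexed by the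
  next digit. If no modulus served on O, there would be nested bad balls whose centres converge,
  contradicting continuity at the limit.\<close>

lemma uniformly_continuous:
  assumes f: "f \<in> cont_funs v" and e: "0 < e"
  obtains n where "\<And>x y. v x \<le> 1 \<Longrightarrow> v y \<le> 1 \<Longrightarrow> v (x - y) \<le> v unif ^ n \<Longrightarrow> v (f x - f y) < e"
proof -
  \<comment> \<open>On the ball of radius \<open>v unif ^ n\<close> around \<open>s\<close>, some
    single N is a modulus of continuity for \<open>e\<close>.\<close>
  define good where "good n s \<longleftrightarrow> (\<exists>N. \<forall>x y. v x \<le> 1 \<and> v y \<le> 1 \<and> v (x - s) \<le> v unif ^ n \<and>
    v (y - s) \<le> v unif ^ n \<and> v (x - y) \<le> v unif ^ N \<longrightarrow> v (f x - f y) < e)" for n s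
  have pow_mono: "v unif ^ m \<le> v unif ^ n" if "n \<le> m" for m n
    using that v_unif_less_1 by (intro power_decreasing) auto
  have split: "\<exists>t\<in>teich. \<not> good (Suc n) (s + t * unif ^ n)" if bad: "\<not> good n s" for n s
  proof (rule ccontr)
    assume "\<not> ?thesis"
    then have "\<forall>t\<in>teich. good (Suc n) (s + t * unif ^ n)"
      by blast
    then obtain N where N: "\<And>t x y. t \<in> teich \<Longrightarrow> v x \<le> 1 \<Longrightarrow> v y \<le> 1 \<Longrightarrow>
        v (x - (s + t * unif ^ n)) \<le> v unif ^ Suc n \<Longrightarrow>
        v (y - (s + t * unif ^ n)) \<le> v unif ^ Suc n \<Longrightarrow> v (x - y) \<le> v unif ^ N t \<Longrightarrow> v (f x - f y) < e"
      unfolding good_def bchoice_iff by auto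
    \<comment> \<open>The finitely many moduli of the smaller balls are combined; including
      \<open>Suc n\<close> ensures that \<open>y\<close> falls into the same smaller ball as
      \<open>x\<close>.\<close>
    define M where "M = Max (insert (Suc n) (N ` teich))"
    have "v (f x - f y) < e" if xy: "v x \<le> 1" "v y \<le> 1" "v (x - s) \<le> v unif ^ n"
      "v (x - y) \<le> v unif ^ M" for x y
    proof -
      define z where "z = (x - s) / unif ^ n"
      define t where "t = residue_digit z"
      have "v z \<le> 1"
        using xy(3) by (simp add: z_def v_divide v_power divide_le_eq)
      note t = residue_digit[OF this, folded t_def]
      have M: "Suc n \<le> M" "N t \<le> M"
        unfolding M_def using t(1) by (auto intro: Max_ge)
      have "z * unif ^ n = x - s"
        by (simp add: z_def)
      then have "x - (s + t * unif ^ n) = (z - t) * unif ^ n"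
        by (simp add: left_diff_distrib)
      then have *: "v (x - (s + t * unif ^ n)) \<le> v unif ^ Suc n"
        using v_le_v_unif[OF t(2)] by (simp add: v_mult v_power mult_right_mono)
      have "v (y - x) \<le> v unif ^ Suc n"
        using order_trans[OF xy(4) pow_mono[OF M(1)]] by (simp add: v_minus_commute)
      then have "v (y - (s + t * unif ^ n)) \<le> v unif ^ Suc n"
        using * by (rule v_triangle)
      then show ?thesis
        using N[OF t(1) xy(1,2) *] order_trans[OF xy(4) pow_mono[OF M(2)]] by simp
    qed
    then show False
      using bad unfolding good_def by blast
  qed
  have "good 0 0"
  proof (rule ccontr)
    assume "\<not> good 0 0"
    then have "\<exists>S. \<forall>n. (v (S n) \<le> 1 \<and> \<not> good n (S n)) \<and> v (S (Suc n) - S n) \<le> v unif ^ n"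
    proof (intro dependent_nat_choice)
      show "\<exists>s. v s \<le> 1 \<and> \<not> good 0 s"
        using \<open>\<not> good 0 0\<close> by (intro exI[of _ 0]) simp
      fix s n assume s: "v s \<le> 1 \<and> \<not> good n s"
      then obtain t where t: "t \<in> teich" "\<not> good (Suc n) (s + t * unif ^ n)"
        using split by blast
      have "v (t * unif ^ n) \<le> v unif ^ n"
        using mult_right_mono[OF v_teich_le[OF t(1)], of "v unif ^ n"] by (simp add: v_mult v_power)
      moreover have "v unif ^ n \<le> 1"
        using pow_mono[of 0 n] by simp
      ultimately show "\<exists>s'. (v s' \<le> 1 \<and> \<not> good (Suc n) s') \<and> v (s' - s) \<le> v unif ^ n"
        using s t(2) v_add_le[of s 1 "t * unif ^ n"] by (intro exI[of _ "s + t * unif ^ n"]) simp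
    qed
    then obtain S where S: "\<And>n. v (S n) \<le> 1" "\<And>n. \<not> good n (S n)"
      and step: "\<And>n. v (S (Suc n) - S n) \<le> v unif ^ n"
      by blast
    have near: "v (S m - S n) \<le> v unif ^ n" if "n \<le> m" for m n
      using that
    proof (induction m rule: dec_induct)
      case (step m)
      then show ?case
        using v_triangle[of "S (Suc m)" "S m" "v unif ^ n" "S n"]
          order_trans[OF \<open>\<And>n. v (S (Suc n) - S n) \<le> v unif ^ n\<close> pow_mono[OF step.hyps(1)]] by simp
    qed simp
    have "\<exists>N. \<forall>n\<ge>N. v (S (Suc n) - S n) \<le> d" if "0 < d" for d
    proof -
      obtain N where N: "v unif ^ N < d"
        using ex_unif_power_less[OF \<open>0 < d\<close>] ..
      have "v (S (Suc n) - S n) \<le> d" if "N \<le> n" for n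
        using step[of n] pow_mono[OF that] N by linarith
      then show ?thesis by blast
    qed
    then obtain L where L: "v_converges v S L"
      by (rule converges_if_steps_small)
    have "v (L - 0) \<le> 1"
      by (rule v_limit_le[OF L, of 0]) (simp add: S(1))
    then obtain d where d: "0 < d" "\<And>y. v y \<le> 1 \<Longrightarrow> v (y - L) < d \<Longrightarrow> v (f y - f L) < e"
      using f e unfolding cont_funs_def val_ring_def by fastforce
    obtain n where n: "v unif ^ n < d"
      using ex_unif_power_less[OF d(1)] ..
    \<comment> \<open>The limit stays in the n-th ball, which therefore lies within distance
      \<open>d\<close> of \<open>L\<close>, where continuity at \<open>L\<close> applies.\<close>
    have Ln: "v (L - S n) \<le> v unif ^ n"
      by (rule v_limit_le[OF L, of n]) (rule near)
    have close: "v (f x - f L) < e" if "v x \<le> 1" "v (x - S n) \<le> v unif ^ n" for x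
      using v_triangle[of x "S n" "v unif ^ n" L] Ln that n
      by (intro d(2)) (simp_all add: v_minus_commute)
    have "v (f x - f y) < e" if "v x \<le> 1" "v y \<le> 1" "v (x - S n) \<le> v unif ^ n"
      "v (y - S n) \<le> v unif ^ n" for x y
      using close[OF that(1,3)] close[OF that(2,4)] v_triangle_less[of "f x" "f L" e "f y"]
      by (simp add: v_minus_commute)
    then have "good n (S n)"
      unfolding good_def by blast
    then show False
      using S(2) by blast
  qed
  then obtain N where N: "\<And>x y. v x \<le> 1 \<and> v y \<le> 1 \<and> v (x - 0) \<le> v unif ^ 0 \<and>
    v (y - 0) \<le> v unif ^ 0 \<and> v (x - y) \<le> v unif ^ N \<Longrightarrow> v (f x - f y) < e"
    unfolding good_def by blast
  show ?thesis
    by (rule that[of N]) (rule N, simp)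
qed

section \<open>Surjectivity with control of the norm\<close>

lemma digit_sum_restrict: "digit_sum n (restrict a {..<n}) = digit_sum n a"
  by (simp add: digit_sum_def)

text \<open>Because interpolation does not enlarge norms, uniform continuity of \<open>f\<close>
  makes the interpolants uniformly Cauchy in their coefficients. The last clause records that the
  limit inherits every bound on \<open>f\<close>, which yields the isometry.\<close>

lemma ex_digit_eval_eq:
  assumes f: "f \<in> cont_funs v"
  shows "\<exists>F\<in>restricted v. digit_eval F = f \<and>
    (\<forall>c\<ge>0. (\<forall>x\<in>val_ring v. v (f x) \<le> c) \<longrightarrow> bounded_by F c)"
proof -
  define P where "P n = interpolate n (\<lambda>b. f (digit_sum n b))" for n
  have cubeD: "b j \<in> teich" if "b \<in> cube n" "j < n" for b j n
    using PiE_mem[OF that(1), of j] that(2) by simp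
  have bound: "bounded_by (lookup (P n)) c" if "0 \<le> c" "\<forall>x\<in>val_ring v. v (f x) \<le> c" for n c
    unfolding P_def
  proof (rule bounded_by_interpolate)
    fix b assume "b \<in> cube n"
    then have "v (digit_sum n b) \<le> 1"
      by (intro v_digit_sum_le cubeD)
    then show "v (f (digit_sum n b)) \<le> c"
      using that(2) by (simp add: val_ring_def)
  qed (rule that(1))
  \<comment> \<open>Moving \<open>P n\<close> to the larger grid turns the difference into one
    interpolant, of the change of \<open>f\<close> between two points at distance at most
    \<open>v unif ^ n\<close>.\<close>
  have diff: "P (Suc n) - P n = interpolate (Suc n) (\<lambda>b. f (digit_sum (Suc n) b) - f (digit_sum n b))" for n
    using interpolate_Suc[of n "\<lambda>b. f (digit_sum n b)"]
    by (simp add: P_def digit_sum_restrict flip: interpolate_diff)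
  have small: "\<exists>N. (\<forall>m\<ge>N. \<forall>n\<ge>m. bounded_by (lookup (P n) - lookup (P m)) e) \<and>
      (\<forall>n\<ge>N. \<forall>x. v x \<le> 1 \<longrightarrow> v (poly_val (digit x) (P n) - f x) \<le> e)" if e: "0 < e" for e
  proof -
    obtain N where N: "\<And>x y. v x \<le> 1 \<Longrightarrow> v y \<le> 1 \<Longrightarrow> v (x - y) \<le> v unif ^ N \<Longrightarrow> v (f x - f y) < e"
      using uniformly_continuous[OF f e] by blast
    have pow_mono: "v unif ^ n \<le> v unif ^ N" if "N \<le> n" for n
      using that v_unif_less_1 by (intro power_decreasing) auto
    have step: "bounded_by (lookup (P (Suc n)) - lookup (P n)) e" if n: "N \<le> n" for n
    proof -
      have "bounded_by (lookup (P (Suc n) - P n)) e"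
        unfolding diff
      proof (rule bounded_by_interpolate)
        fix b assume b: "b \<in> cube (Suc n)"
        have bt: "b j \<in> teich" if "j < Suc n" for j
          using cubeD[OF b that] .
        have "digit_sum (Suc n) b - digit_sum n b = b n * unif ^ n"
          by (simp add: digit_sum_def)
        then have "v (digit_sum (Suc n) b - digit_sum n b) \<le> v unif ^ n"
          using mult_right_mono[OF v_teich_le[OF bt[of n]], of "v unif ^ n"] by (simp add: v_mult v_power)
        then have "v (digit_sum (Suc n) b - digit_sum n b) \<le> v unif ^ N"
          using pow_mono[OF n] by simp
        moreover have "v (digit_sum (Suc n) b) \<le> 1"
          using bt by (rule v_digit_sum_le)
        moreover have "v (digit_sum n b) \<le> 1"
          by (rule v_digit_sum_le) (simp add: bt)
        ultimately show "v (f (digit_sum (Suc n) b) - f (digit_sum n b)) \<le> e"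
          by (simp add: N less_imp_le)
      qed (use e in simp)
      then show ?thesis
        by (simp add: bounded_by_def lookup_minus)
    qed
    have "bounded_by (lookup (P n) - lookup (P m)) e" if "N \<le> m" "m \<le> n" for m n
      using that(2)
    proof (induction n rule: dec_induct)
      case base
      then show ?case
        using e by (simp add: bounded_by_def)
    next
      case (step n)
      have "bounded_by (lookup (P (Suc n)) - lookup (P n)) e"
        using that(1) step.hyps(1) by (intro \<open>\<And>n. N \<le> n \<Longrightarrow> bounded_by (lookup (P (Suc n)) - lookup (P n)) e\<close>) simp
      then show ?case
        using step.IH by (rule bounded_by_triangle)
    qed
    moreover have "v (poly_val (digit x) (P n) - f x) \<le> e" if n: "N \<le> n" and x: "v x \<le> 1" for n x
    proof -
      have "poly_val (digit x) (P n) = f (digit_sum n (digit x))"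
        unfolding P_def by (subst poly_val_interpolate) (simp_all add: digit_in_teich[OF x] digit_sum_restrict)
      moreover have "v (digit_sum n (digit x)) \<le> 1"
        by (rule v_digit_sum_le) (rule digit_in_teich[OF x])
      moreover have "v (digit_sum n (digit x) - x) \<le> v unif ^ N"
        using v_diff_digit_sum_le[OF x, of n] pow_mono[OF n] by simp
      ultimately show ?thesis
        using N x by (simp add: less_imp_le)
    qed
    ultimately show ?thesis by blast
  qed
  have "\<exists>L. v_converges v (\<lambda>n. lookup (P n) m) L" for m
  proof -
    have "\<exists>N. \<forall>n\<ge>N. v (lookup (P (Suc n)) m - lookup (P n) m) \<le> e" if e: "0 < e" for e
    proof -
      obtain N where N: "\<And>m n. N \<le> m \<Longrightarrow> m \<le> n \<Longrightarrow> bounded_by (lookup (P n) - lookup (P m)) e"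
        using small[OF e] by blast
      have "v (lookup (P (Suc n)) m - lookup (P n) m) \<le> e" if "N \<le> n" for n
        using bounded_byD[OF N[of n "Suc n"], of m] that by simp
      then show ?thesis by blast
    qed
    then show ?thesis
      using converges_if_steps_small[of "\<lambda>n. lookup (P n) m"] by blast
  qed
  then obtain F where F: "\<And>m. v_converges v (\<lambda>n. lookup (P n) m) (F m)"
    by metis
  \<comment> \<open>Bounds pass to the coefficientwise limit. Used with \<open>g\<close> an
    interpolant for the approximation of \<open>F\<close>, and with \<open>g\<close> = 0 for its
    norm.\<close>
  have F_le: "bounded_by (F - g) c" if "\<And>n. n \<ge> N \<Longrightarrow> bounded_by (lookup (P n) - g) c" for g c N
    unfolding bounded_by_def
  proof
    fix m
    have "v (F m - g m) \<le> c"
      by (rule v_limit_le[OF F[of m], of N]) (use bounded_byD[OF that, of _ m] in simp)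
    then show "v ((F - g) m) \<le> c"
      by simp
  qed
  have approx: "\<exists>p. bounded_by (F - lookup p) e \<and> (\<forall>x. v x \<le> 1 \<longrightarrow> v (poly_val (digit x) p - f x) \<le> e)"
    if e: "0 < e" for e
  proof -
    obtain N where N: "\<And>m n. N \<le> m \<Longrightarrow> m \<le> n \<Longrightarrow> bounded_by (lookup (P n) - lookup (P m)) e"
      "\<And>n x. N \<le> n \<Longrightarrow> v x \<le> 1 \<Longrightarrow> v (poly_val (digit x) (P n) - f x) \<le> e"
      using small[OF e] by blast
    have "bounded_by (F - lookup (P N)) e"
      by (rule F_le[of N]) (simp add: N(1))
    then show ?thesis
      using N(2)[of N] by blast
  qed
  have F_res: "F \<in> restricted v"
    by (rule restrictedI) (use approx in blast)
  have "digit_eval F x = f x" for x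
  proof (cases "x \<in> val_ring v")
    case True
    then have x: "v x \<le> 1"
      by (simp add: val_ring_def)
    have "eval (digit x) F = f x"
    proof (rule eval_eqI[OF unit_seq_digit[OF x] F_res])
      fix e :: real assume "0 < e"
      then obtain p where "bounded_by (F - lookup p) e" "v (poly_val (digit x) p - f x) \<le> e"
        using approx x by blast
      then show "\<exists>p. bounded_by (F - lookup p) e \<and> v (f x - poly_val (digit x) p) \<le> e"
        using v_minus_commute[of "f x"] by auto
    qed
    then show ?thesis
      using True by (simp add: digit_eval_def)
  next
    case False
    then show ?thesis
      using f by (simp add: digit_eval_def cont_funs_def)
  qed
  moreover have "bounded_by F c" if "0 \<le> c" "\<forall>x\<in>val_ring v. v (f x) \<le> c" for c
    using F_le[of 0 0 c] bound[OF that] by simp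
  ultimately show ?thesis
    using F_res by (intro bexI[of _ F]) auto
qed

section \<open>Quotient classes and the residue norm\<close>

lemma digit_eval_add:
  "f \<in> restricted v \<Longrightarrow> g \<in> restricted v \<Longrightarrow> digit_eval (f + g) = digit_eval f + digit_eval g"
  by (rule ext) (simp add: digit_eval_def eval_add unit_seq_digit val_ring_def)

lemma digit_eval_mult:
  "f \<in> restricted v \<Longrightarrow> g \<in> restricted v \<Longrightarrow>
    digit_eval (rs_mult f g) = (\<lambda>x. digit_eval f x * digit_eval g x)"
  by (rule ext) (simp add: digit_eval_def eval_mult unit_seq_digit val_ring_def)

lemma digit_eval_smult:
  "f \<in> restricted v \<Longrightarrow> digit_eval (rs_smult c f) = (\<lambda>x. c * digit_eval f x)"
  by (rule ext) (simp add: digit_eval_def eval_smult unit_seq_digit val_ring_def)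

lemma digit_eval_one: "digit_eval rs_one = (\<lambda>x. if x \<in> val_ring v then 1 else 0)"
  by (rule ext) (simp add: digit_eval_def rs_one_eq eval_lookup unit_seq_digit val_ring_def)

lemma diff_in_Iq_iff:
  assumes "f \<in> restricted v" "g \<in> restricted v"
  shows "f - g \<in> Iq v q \<longleftrightarrow> digit_eval f = digit_eval g"
  using assms
  by (auto simp: Iq_iff restricted_diff eval_diff unit_seq_digit digit_eval_def fun_eq_iff val_ring_def)

lemma quot_class_eq:
  "f \<in> restricted v \<Longrightarrow> quot_class v q f = {g \<in> restricted v. digit_eval g = digit_eval f}"
  by (auto simp: quot_class_def diff_in_Iq_iff)

text \<open>The infimum is attained. Every representative has norm at least the sup-norm since
  evaluation does not increase norms, and the preimage \<open>F\<close> supplied by interpolation is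
  a representative that reaches it.\<close>

lemma sup_norm_digit_eval:
  assumes f: "f \<in> restricted v"
  shows "sup_norm v (digit_eval f) = residue_norm v q f"
proof -
  define s where "s = sup_norm v (digit_eval f)"
  have zero: "0 \<in> val_ring v"
    by (simp add: val_ring_def)
  have "bdd_above ((\<lambda>x. v (digit_eval f x)) ` val_ring v)"
    by (rule bdd_aboveI2[of _ _ "rs_norm v f"]) (rule v_digit_eval_le[OF f bounded_by_rs_norm[OF f]])
  then have upper: "v (digit_eval f x) \<le> s" if "x \<in> val_ring v" for x
    unfolding s_def sup_norm_def using that by (intro cSUP_upper)
  then have "0 \<le> s"
    using order_trans[OF v_nonneg upper[OF zero]] by simp
  obtain F where F: "F \<in> restricted v" "digit_eval F = digit_eval f" "bounded_by F s"
    using ex_digit_eval_eq[OF digit_eval_in_cont_funs[OF f]] \<open>0 \<le> s\<close> upper by blast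
  have least: "s \<le> rs_norm v (f + h)" if h: "h \<in> Iq v q" for h
  proof -
    have h': "h \<in> restricted v" "\<And>x. v x \<le> 1 \<Longrightarrow> eval (digit x) h = 0"
      using h by (simp_all add: Iq_iff)
    note fh = restricted_add[OF f h'(1)]
    have "digit_eval (f + h) = digit_eval f"
      unfolding digit_eval_add[OF f h'(1)] using h'(2)
      by (auto simp: digit_eval_def val_ring_def)
    then have "v (digit_eval f x) \<le> rs_norm v (f + h)" for x
      using v_digit_eval_le[OF fh bounded_by_rs_norm[OF fh], of x] by simp
    then show ?thesis
      unfolding s_def sup_norm_def using zero by (intro cSUP_least) auto
  qed
  have F_f: "F - f \<in> Iq v q"
    using F(1,2) f by (simp add: diff_in_Iq_iff)
  then have "rs_norm v (f + (F - f)) = s"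
    using least[OF F_f] rs_norm_le[OF F(3)] by simp
  then have "s \<in> {rs_norm v (f + h) |h. h \<in> Iq v q}"
    using F_f by blast
  then have "Inf {rs_norm v (f + h) |h. h \<in> Iq v q} = s"
    by (rule cInf_eq_minimum) (use least in blast)
  then show ?thesis
    by (simp add: s_def residue_norm_def)
qed

end

theorem theorem6p2:
  fixes v :: "'k::field \<Rightarrow> real" and q :: nat
  assumes "local_field v"
    and "q = card (residue_field v)"
  shows "\<exists>\<psi>. bij_betw \<psi> (rs_quotient v q) (cont_funs v)
     \<and> (\<forall>f\<in>restricted v. \<forall>g\<in>restricted v.
          \<psi> (quot_class v q (f + g)) = \<psi> (quot_class v q f) + \<psi> (quot_class v q g)
        \<and> \<psi> (quot_class v q (rs_mult f g)) = (\<lambda>x. \<psi> (quot_class v q f) x * \<psi> (quot_class v q g) x))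
     \<and> (\<forall>c. \<forall>f\<in>restricted v.
          \<psi> (quot_class v q (rs_smult c f)) = (\<lambda>x. c * \<psi> (quot_class v q f) x))
     \<and> \<psi> (quot_class v q rs_one) = (\<lambda>x. if x \<in> val_ring v then 1 else 0)
     \<and> (\<forall>f\<in>restricted v. sup_norm v (\<psi> (quot_class v q f)) = residue_norm v q f)"
proof -
  interpret nonarch_local_field v q
    using assms by unfold_locales (simp_all add: local_field_def)
  \<comment> \<open>The choice of representative is harmless: by \<open>quot_class_eq\<close> the
    classes are exactly the fibres of \<open>digit_eval\<close>, which also gives
    injectivity.\<close>
  define \<psi> where "\<psi> C = digit_eval (SOME f. f \<in> C)" for C
  have \<psi>: "\<psi> (quot_class v q f) = digit_eval f" if f: "f \<in> restricted v" for f
  proof -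
    have "f \<in> quot_class v q f"
      using f by (simp add: quot_class_eq)
    then have "(SOME g. g \<in> quot_class v q f) \<in> quot_class v q f"
      by (rule someI[of "\<lambda>g. g \<in> quot_class v q f"])
    then show ?thesis
      unfolding \<psi>_def by (simp add: quot_class_eq[OF f])
  qed
  have "bij_betw \<psi> (rs_quotient v q) (cont_funs v)"
    unfolding bij_betw_def
  proof
    show "inj_on \<psi> (rs_quotient v q)"
    proof
      fix A B assume "A \<in> rs_quotient v q" "B \<in> rs_quotient v q" "\<psi> A = \<psi> B"
      then show "A = B"
        unfolding rs_quotient_def by (elim imageE) (simp only: \<psi>, simp only: quot_class_eq)
    qed
    show "\<psi> ` rs_quotient v q = cont_funs v"
    proof
      show "\<psi> ` rs_quotient v q \<subseteq> cont_funs v"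
        by (auto simp: rs_quotient_def \<psi> digit_eval_in_cont_funs)
      show "cont_funs v \<subseteq> \<psi> ` rs_quotient v q"
      proof
        fix g assume "g \<in> cont_funs v"
        then obtain F where "F \<in> restricted v" "digit_eval F = g"
          using ex_digit_eval_eq by blast
        then show "g \<in> \<psi> ` rs_quotient v q"
          unfolding rs_quotient_def image_image by (intro image_eqI[of _ _ F]) (simp_all add: \<psi>)
      qed
    qed
  qed
  moreover have "rs_one \<in> restricted v"
    by (simp add: rs_one_eq)
  ultimately show ?thesis
    by (intro exI[of _ \<psi>]) (simp add: \<psi> restricted_add restricted_mult restricted_smult
        digit_eval_add digit_eval_mult digit_eval_smult digit_eval_one sup_norm_digit_eval)
qed

end
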